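(* Let $\mu(x,dy)$ be a jump kernel on $\mathbf{R}^d$ and $m$ a positive Radon measure on $\mathbf{R}^d$ with full support such that $\mu(x,dy)m(dx)=\mu(y,dx)m(dy)$, and assume there exist $R_0>3r_0>0$ such that $\mu(x,B(x,R_0)\setminus B(x,r_0))>0$ for every $x\in\mathbf{R}^d$. Let $1\le p<\infty$ and let $q$ be its conjugate, that is, $1/p+1/q=1$. If $M_\alpha<\infty$ for some $0<\alpha\le2$, then $$\int\Gamma(f,gh)(x)\,m(dx)=\int g(x)\Gamma(f,h)(x)\,m(dx)+\int h(x)\Gamma(f,g)(x)\,m(dx)$$ for all $f\in\mathcal{F}_{\rm loc}\cap L^p(\mathbf{R}^d;m)$, $g\in\mathcal{F}_{\rm loc}\cap L^q(\mathbf{R}^d;m)$ and $h\in C_K^{\rm lip}$.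
   Context: A jump kernel $\mu(x,dy)$ on $\mathbf{R}^d\times\mathcal{B}(\mathbf{R}^d)$ means: for each $x\in\mathbf{R}^d$, $B\mapsto\mu(x,B)$ is a positive measure on $\mathcal{B}(\mathbf{R}^d\setminus\{x\})$, and $x\mapsto\mu(x,B)$ is Borel measurable for every $B\in\mathcal{B}(\mathbf{R}^d\setminus\{x\})$. The symmetry $\mu(x,dy)m(dx)=\mu(y,dx)m(dy)$ is an equality of measures on $\{(x,y)\in\mathbf{R}^d\times\mathbf{R}^d: x\ne y\}$. $B(x,R)$ is the ball of radius $R$ centered at $x$. For $0\le\alpha\le 2$, $$M_\alpha=\sup_{x\in\mathbf{R}^d}\int_{y\ne x}\left(1\wedge|x-y|^\alpha\right)\mu(x,dy);$$ $M_2\le M_\beta\le M_\alpha$ for $\alpha\le\beta\le2$. $C_K^{\rm lip}$ is the space of uniformly Lipschitz continuous functions on $\mathbf{R}^d$ with compact support. Put $$\mathcal{E}(f,g)=\iint_{x\ne y}(f(x)-f(y))(g(x)-g(y))\,\mu(x,dy)m(dx).$$ When $M_2<\infty$, $(\mathcal{E},C_K^{\rm lip})$ is a closable Markovian form on $L^2(\mathbf{R}^d;m)$; $\mathcal{F}$ denotes the domain of its closure, i.e. the closure of $C_K^{\rm lip}$ with respect to the norm $(\mathcal{E}(\cdot,\cdot)+\|\cdot\|_{L^2}^2)^{1/2}$. $\mathcal{F}_{\rm loc}$ is the set of measurable functions $f$ on $\mathbf{R}^d$ such that for every relatively compact set $O$ there is $g\in\mathcal{F}$ with $f=g$ $m$-a.e.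 on $O$. The carré du champ is $$\Gamma(f,g)(x)=\int_{y\ne x}(f(x)-f(y))(g(x)-g(y))\,\mu(x,dy),\quad x\in\mathbf{R}^d.$$ *)

theory Defs
  imports "HOL-Analysis.Analysis" "HOL-Probability.Essential_Supremum"
begin

text \<open>The measure \<open>\<mu> x\<close> lives on the Borel sets of the punctured space \<open>- {x}\<close>, so every integral
  with respect to \<open>\<mu> x\<close> below is an integral over \<open>y \<noteq> x\<close>. Since the \<open>\<sigma>\<close>-algebra depends on \<open>x\<close>,
  measurability in \<open>x\<close> is stated for the sets \<open>B - {x}\<close> with \<open>B\<close> Borel in the whole space.\<close>

definition jump_kernel :: "('a::euclidean_space \<Rightarrow> 'a measure) \<Rightarrow> bool" where
  "jump_kernel \<mu> \<longleftrightarrow>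
     (\<forall>x. sets (\<mu> x) = sets (restrict_space borel (- {x}))) \<and>
     (\<forall>B \<in> sets borel. (\<lambda>x. emeasure (\<mu> x) (B - {x})) \<in> borel_measurable borel)"

text \<open>On a Euclidean space a locally finite Borel measure is automatically inner and outer regular.\<close>

definition radon_measure :: "'a::euclidean_space measure \<Rightarrow> bool" where
  "radon_measure m \<longleftrightarrow> sets m = sets borel \<and> (\<forall>K. compact K \<longrightarrow> emeasure m K < \<infinity>)"

definition full_support :: "'a::euclidean_space measure \<Rightarrow> bool" where
  "full_support m \<longleftrightarrow> (\<forall>U. open U \<and> U \<noteq> {} \<longrightarrow> emeasure m U > 0)"

text \<open>Equality of \<open>\<mu>(x,dy) m(dx)\<close> and \<open>\<mu>(y,dx) m(dy)\<close> as measures on the off-diagonal set.\<close>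

definition symmetric_kernel ::
    "('a::euclidean_space \<Rightarrow> 'a measure) \<Rightarrow> 'a measure \<Rightarrow> bool" where
  "symmetric_kernel \<mu> m \<longleftrightarrow>
     (\<forall>C \<in> sets (borel :: ('a \<times> 'a) measure). C \<subseteq> {(x, y). x \<noteq> y} \<longrightarrow>
        (\<integral>\<^sup>+ x. emeasure (\<mu> x) {y. (x, y) \<in> C} \<partial>m) =
        (\<integral>\<^sup>+ y. emeasure (\<mu> y) {x. (x, y) \<in> C} \<partial>m))"

definition jump_moment :: "('a::euclidean_space \<Rightarrow> 'a measure) \<Rightarrow> real \<Rightarrow> ennreal" where
  "jump_moment \<mu> \<alpha> = (SUP x. \<integral>\<^sup>+ y. ennreal (min 1 (norm (x - y) powr \<alpha>)) \<partial>\<mu> x)"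

definition Lp_space :: "ennreal \<Rightarrow> 'a measure \<Rightarrow> ('a \<Rightarrow> real) set" where
  "Lp_space p m = {f \<in> borel_measurable m.
     if p = \<infinity> then esssup m (\<lambda>x. ennreal \<bar>f x\<bar>) < \<infinity>
     else integrable m (\<lambda>x. \<bar>f x\<bar> powr enn2real p)}"

definition lip_compact_support :: "('a::euclidean_space \<Rightarrow> real) set" where
  "lip_compact_support = {f. (\<exists>L. L-lipschitz_on UNIV f) \<and> compact (closure {x. f x \<noteq> 0})}"

text \<open>The Bochner integral is \<open>0\<close> where the integral does not exist; whether
  \<open>carre_du_champ \<mu> f g x\<close> is meaningful is recorded by \<open>carre_du_champ_exists\<close>.\<close>

definition carre_du_champ ::
    "('a::euclidean_space \<Rightarrow> 'a measure) \<Rightarrow> ('a \<Rightarrow> real) \<Rightarrow> ('a \<Rightarrow> real) \<Rightarrow> 'a \<Rightarrow> real" where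
  "carre_du_champ \<mu> f g x = (LINT y|\<mu> x. (f x - f y) * (g x - g y))"

definition carre_du_champ_exists ::
    "('a::euclidean_space \<Rightarrow> 'a measure) \<Rightarrow> ('a \<Rightarrow> real) \<Rightarrow> ('a \<Rightarrow> real) \<Rightarrow> 'a \<Rightarrow> bool" where
  "carre_du_champ_exists \<mu> f g x \<longleftrightarrow> integrable (\<mu> x) (\<lambda>y. (f x - f y) * (g x - g y))"

text \<open>The form and its norm are used only on \<open>lip_compact_support\<close>, where all integrals converge
  absolutely if the second moment is finite.\<close>

definition energy_form ::
    "('a::euclidean_space \<Rightarrow> 'a measure) \<Rightarrow> 'a measure \<Rightarrow> ('a \<Rightarrow> real) \<Rightarrow> ('a \<Rightarrow> real) \<Rightarrow> real" where
  "energy_form \<mu> m f g = (LINT x|m. (LINT y|\<mu> x. (f x - f y) * (g x - g y)))"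

definition energy_norm ::
    "('a::euclidean_space \<Rightarrow> 'a measure) \<Rightarrow> 'a measure \<Rightarrow> ('a \<Rightarrow> real) \<Rightarrow> real" where
  "energy_norm \<mu> m f = sqrt (energy_form \<mu> m f f + (LINT x|m. (f x)\<^sup>2))"

text \<open>Domain of the closure of the closable form: the \<open>L\<^sup>2\<close> limits of sequences in
  \<open>lip_compact_support\<close> that are Cauchy for the energy norm, i.e. the completion of
  \<open>lip_compact_support\<close> in that norm realised inside \<open>L\<^sup>2\<close>. Members are functions rather than classes;
  the set is closed under changes on null sets.\<close>

definition form_domain ::
    "('a::euclidean_space \<Rightarrow> 'a measure) \<Rightarrow> 'a measure \<Rightarrow> ('a \<Rightarrow> real) set" where
  "form_domain \<mu> m = {f \<in> Lp_space 2 m.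
     \<exists>u :: nat \<Rightarrow> 'a \<Rightarrow> real.
       (\<forall>n. u n \<in> lip_compact_support) \<and>
       (\<forall>e > 0. \<exists>N. \<forall>j \<ge> N. \<forall>k \<ge> N. energy_norm \<mu> m (\<lambda>x. u j x - u k x) < e) \<and>
       (\<lambda>n. LINT x|m. (u n x - f x)\<^sup>2) \<longlonglongrightarrow> 0}"

definition local_form_domain ::
    "('a::euclidean_space \<Rightarrow> 'a measure) \<Rightarrow> 'a measure \<Rightarrow> ('a \<Rightarrow> real) set" where
  "local_form_domain \<mu> m = {f \<in> borel_measurable m.
     \<forall>V. compact (closure V) \<longrightarrow>
       (\<exists>g \<in> form_domain \<mu> m. AE x in m. x \<in> V \<longrightarrow> f x = g x)}"

end

theory Submission
  imports Defs
begin

text \<open>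
  Write \<open>J\<close> for the symmetric measure \<open>\<mu>(x,dy) m(dx)\<close> off the diagonal. From
  \<open>(f x - f y) (g x h x - g y h y) = g x (f x - f y) (h x - h y) + h y (f x - f y) (g x - g y)\<close>
  the identity follows by Fubini and by exchanging \<open>x\<close> and \<open>y\<close> in the last term, once every term is
  \<open>J\<close>-integrable. Where \<open>dist x y < 1\<close>, the support of \<open>h\<close> confines both variables to a ball, on
  which \<open>f\<close> and \<open>g\<close> have finite energy and are square integrable, so that \<open>2 a b \<le> a\<^sup>2 + b\<^sup>2\<close> suffices.
  Where \<open>dist x y \<ge> 1\<close>, the kernels \<open>\<mu>(x,\<cdot>)\<close> have uniformly bounded mass, and Young's inequality
  bounds the products \<open>f x g y\<close> by integrable functions of one variable.
\<close>

section \<open>Covering the off-diagonal set by separated rectangles\<close>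

text \<open>The rectangles are products of balls of rational radius \<open>r\<close> with centres in
  a countable dense set. Centres more than \<open>3 * r\<close> apart leave a gap of at least
  \<open>r\<close> between the two balls, and this gap is \<open>d i\<close>.\<close>

lemma off_diagonal_cover:
  obtains U V :: "nat \<Rightarrow> 'a::euclidean_space set" and d :: "nat \<Rightarrow> real"
  where "\<And>i. open (U i)" "\<And>i. open (V i)" "\<And>i. d i > 0"
    "\<And>i x y. x \<in> U i \<Longrightarrow> y \<in> V i \<Longrightarrow> d i \<le> dist x y"
    "\<And>x y. x \<noteq> y \<Longrightarrow> \<exists>i. x \<in> U i \<and> y \<in> V i"
proof -
  obtain D :: "'a set" where D: "countable D" "\<And>X. open X \<Longrightarrow> X \<noteq> {} \<Longrightarrow> \<exists>d\<in>D. d \<in> X"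
    using countable_dense_setE by blast
  define I where "I = D \<times> D \<times> ({r::real. r \<in> \<rat> \<and> r > 0})"
  have "countable I"
    unfolding I_def using D(1) countable_rat by (auto intro!: countable_SIGMA countable_subset[OF _ countable_rat])
  moreover have "I \<noteq> {}"
    using D(2)[of UNIV] by (auto simp: I_def intro: exI[of _ 1])
  ultimately have e: "range (from_nat_into I) = I"
    by (intro range_from_nat_into)
  define e where "e = from_nat_into I"
  note e = e[folded e_def]
  define U where "U i = (case e i of (a, b, r) \<Rightarrow> if 3 * r < dist a b then ball a r else {})" for i
  define V where "V i = (case e i of (a, b, r) \<Rightarrow> ball b r)" for i
  define d where "d i = (case e i of (a, b, r) \<Rightarrow> r)" for i
  have eI: "e i \<in> I" for i using e by auto
  show thesis
  proof (rule that)
    show "open (U i)" "open (V i)" for i by (auto simp: U_def V_def split: prod.split)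
    show "d i > 0" for i using eI[of i] by (auto simp: d_def I_def split: prod.split)
    show "d i \<le> dist x y" if "x \<in> U i" "y \<in> V i" for i x y
    proof -
      obtain a b r where e_i: "e i = (a, b, r)" by (cases "e i") auto
      have *: "3 * r < dist a b" "dist a x < r" "dist b y < r"
        using that by (auto simp: U_def V_def e_i split: if_splits)
      have "dist a b \<le> dist a x + dist x y + dist b y"
        using dist_triangle[of a b x] dist_triangle[of x b y] dist_commute[of b y] by linarith
      then show ?thesis using * by (simp add: d_def e_i)
    qed
    show "\<exists>i. x \<in> U i \<and> y \<in> V i" if "x \<noteq> y" for x y
    proof -
      \<comment> \<open>Moving \<open>x\<close> and \<open>y\<close> to nearby centres costs at most
        \<open>2 * r\<close>, so a distance above \<open>5 * r\<close> leaves centres more than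
        \<open>3 * r\<close> apart.\<close>
      obtain r where r: "r \<in> \<rat>" "0 < r" "r < dist x y / 5"
        using Rats_dense_in_real[of 0 "dist x y / 5"] \<open>x \<noteq> y\<close> by auto
      obtain a b where ab: "a \<in> D" "a \<in> ball x r" "b \<in> D" "b \<in> ball y r"
        using D(2)[of "ball x r"] D(2)[of "ball y r"] r by auto
      have "(a, b, r) \<in> I" using ab r by (simp add: I_def)
      then obtain i where i: "e i = (a, b, r)" using e by (metis imageE)
      have "dist x y \<le> dist x a + dist a b + dist y b"
        using dist_triangle[of x y a] dist_triangle[of a y b] dist_commute[of b y] by linarith
      then have "3 * r < dist a b" using ab r by simp
      then have "x \<in> U i \<and> y \<in> V i"
        using ab by (simp add: U_def V_def i dist_commute)
      then show ?thesis ..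
    qed
  qed
qed

section \<open>Symmetric jump kernels and measurability of their sections\<close>

text \<open>The bound \<open>M\<close> is a parameter so that any finite majorant of the quadratic
  moment fits. The final theorem takes \<open>jump_moment \<mu> \<alpha>\<close>, which is one
  because \<open>\<alpha> \<le> 2\<close>.\<close>

locale symmetric_jump =
  fixes \<mu> :: "'a::euclidean_space \<Rightarrow> 'a measure" and m :: "'a measure" and M :: ennreal
  assumes kernel: "jump_kernel \<mu>"
    and radon: "radon_measure m"
    and symmetric: "symmetric_kernel \<mu> m"
    and M_finite: "M < \<infinity>"
    and moment: "\<And>x. (\<integral>\<^sup>+ y. ennreal (min 1 ((dist x y)\<^sup>2)) \<partial>\<mu> x) \<le> M"
begin

lemma sets_m [simp, measurable_cong]: "sets m = sets borel"
  using radon by (simp add: radon_measure_def)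

lemma space_m [simp]: "space m = UNIV"
  using sets_eq_imp_space_eq[OF sets_m] by simp

lemma measurable_m [simp]: "measurable m N = measurable borel N"
  by (rule measurable_cong_sets) simp_all

lemma sets_kernel: "sets (\<mu> x) = sets (restrict_space borel (- {x}))"
  using kernel by (simp add: jump_kernel_def)

lemma space_kernel [simp]: "space (\<mu> x) = - {x}"
  using sets_eq_imp_space_eq[OF sets_kernel] by (simp add: space_restrict_space)

lemma measurable_kernel: "f \<in> measurable borel N \<Longrightarrow> f \<in> measurable (\<mu> x) N"
  by (subst measurable_cong_sets[OF sets_kernel refl]) (rule measurable_restrict_space1)

lemma sets_kernel_iff: "A \<in> sets (\<mu> x) \<longleftrightarrow> A \<in> sets borel \<and> x \<notin> A"
  unfolding sets_kernel by (subst sets_restrict_space_iff) auto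

lemma section_sets: "C \<in> sets (borel \<Otimes>\<^sub>M borel) \<Longrightarrow> {y. y \<noteq> x \<and> (x, y) \<in> C} \<in> sets (\<mu> x)"
  unfolding sets_kernel_iff by auto

text \<open>Chebyshev's inequality: on \<open>A\<close> the weight of the moment bound is at least
  \<open>min 1 (d\<^sup>2)\<close>, which is positive.\<close>

lemma emeasure_kernel_apart:
  assumes "A \<in> sets borel" "d > 0" "\<And>y. y \<in> A \<Longrightarrow> d \<le> dist x y"
  shows "emeasure (\<mu> x) A < \<infinity>"
proof -
  define c where "c = min 1 (d\<^sup>2)"
  have c: "c > 0" using assms by (simp add: c_def)
  have A: "A \<in> sets (\<mu> x)" using assms by (force simp: sets_kernel_iff)
  have "ennreal c * emeasure (\<mu> x) A = (\<integral>\<^sup>+ y. ennreal c * indicator A y \<partial>\<mu> x)"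
    using A by (simp add: nn_integral_cmult_indicator)
  also have "\<dots> \<le> (\<integral>\<^sup>+ y. ennreal (min 1 ((dist x y)\<^sup>2)) \<partial>\<mu> x)"
    using assms by (intro nn_integral_mono) (auto simp: c_def min.coboundedI2 split: split_indicator intro!: ennreal_leI power_mono)
  also have "\<dots> < \<infinity>" using moment M_finite by (rule le_less_trans)
  finally show ?thesis using c by (auto simp: ennreal_mult_less_top)
qed

text \<open>The measures \<open>\<mu> x\<close> may be infinite, so the monotone class argument is applied on rectangles
  \<open>U i \<times> V i\<close> at positive distance from the diagonal, where \<open>\<mu> x (V i)\<close> is finite.\<close>

lemma measurable_emeasure_section:
  assumes C: "C \<in> sets (borel \<Otimes>\<^sub>M borel)"
  shows "(\<lambda>x. emeasure (\<mu> x) {y. y \<noteq> x \<and> (x, y) \<in> C}) \<in> borel_measurable borel"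
proof -
  obtain U V :: "nat \<Rightarrow> 'a set" and d :: "nat \<Rightarrow> real"
    where U: "\<And>i. open (U i)" and V: "\<And>i. open (V i)" and d: "\<And>i. d i > 0"
    and UV: "\<And>i x y. x \<in> U i \<Longrightarrow> y \<in> V i \<Longrightarrow> d i \<le> dist x y"
    and cover: "\<And>x y. x \<noteq> y \<Longrightarrow> \<exists>i. x \<in> U i \<and> y \<in> V i"
    by (rule off_diagonal_cover) (rule that)
  have V_fin: "emeasure (\<mu> x) (V i) < \<infinity>" if "x \<in> U i" for x i
    using that UV V d by (intro emeasure_kernel_apart[of _ "d i"]) auto
  have V_sets: "A \<inter> V i \<in> sets (\<mu> x)" if "A \<in> sets borel" "x \<in> U i" for x i A
    using that UV[of x i x] d[of i] V[of i] by (auto simp: sets_kernel_iff)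
  have ev [measurable]: "(\<lambda>x. emeasure (\<mu> x) (B - {x})) \<in> borel_measurable borel" if "B \<in> sets borel" for B
    using that kernel by (simp add: jump_kernel_def)
  \<comment> \<open>The value 0 off \<open>U i\<close> is a cut-off: for \<open>x \<in> U i\<close>
    the set \<open>V i\<close> avoids \<open>x\<close> and has finite mass, neither of which is
    known elsewhere.\<close>
  let ?s = "\<lambda>i Q x. if x \<in> U i then emeasure (\<mu> x) (Pair x -` Q \<inter> V i) else 0"
  have loc: "?s i Q \<in> borel_measurable borel" if Q: "Q \<in> sets (borel \<Otimes>\<^sub>M borel)" for i Q
  proof -
    have sec: "Pair x -` Q \<in> sets borel" if "Q \<in> sets (borel \<Otimes>\<^sub>M borel)" for x :: 'a and Q :: "('a \<times> 'a) set"
      using sets_Pair1[OF that] by simp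
    have Ui: "U i \<in> sets borel" using U by simp
    have rect: "(\<lambda>x. if x \<in> U i then emeasure (\<mu> x) (A \<inter> V i) else 0) \<in> borel_measurable borel"
      if "A \<in> sets borel" for A
    proof -
      \<comment> \<open>The kernel axiom speaks of \<open>B - {x}\<close>; removing \<open>x\<close>
        changes nothing here, since \<open>V i\<close> does not contain it.\<close>
      have "(\<lambda>x. if x \<in> U i then emeasure (\<mu> x) (A \<inter> V i) else 0) =
        (\<lambda>x. if x \<in> U i then emeasure (\<mu> x) (A \<inter> V i - {x}) else 0)"
        using V_sets[OF that] by (auto simp: fun_eq_iff sets_kernel_iff)
      also have "\<dots> \<in> borel_measurable borel"
        using that V[of i] Ui by measurable
      finally show ?thesis .
    qed
    show ?thesis
      using Int_stable_pair_measure_generator pair_measure_closed Q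
      unfolding sets_pair_measure
    proof (induct rule: sigma_sets_induct_disjoint)
      case (basic Q)
      then obtain A B where Q: "Q = A \<times> B" "A \<in> sets borel" "B \<in> sets borel" by auto
      have "?s i Q = (\<lambda>x. if x \<in> A then (if x \<in> U i then emeasure (\<mu> x) (B \<inter> V i) else 0) else 0)"
        by (auto simp: Q fun_eq_iff)
      then show ?case using Q rect[of B] by (auto intro!: measurable_If)
    next
      case empty
      then show ?case by (simp cong: if_cong)
    next
      case (compl Q)
      have Q: "Q \<in> sets (borel \<Otimes>\<^sub>M borel)" using compl(1) unfolding sets_pair_measure by simp
      have "?s i (space borel \<times> space borel - Q) = (\<lambda>x. (if x \<in> U i then emeasure (\<mu> x) (UNIV \<inter> V i) else 0) - ?s i Q x)"
      proof
        fix x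
        \<comment> \<open>Complements are taken inside \<open>V i\<close>, whose finite mass makes
          the subtraction legitimate.\<close>
        have "emeasure (\<mu> x) (Pair x -` (- Q) \<inter> V i) = emeasure (\<mu> x) (V i) - emeasure (\<mu> x) (Pair x -` Q \<inter> V i)"
          if x: "x \<in> U i"
        proof -
          have "emeasure (\<mu> x) (Pair x -` Q \<inter> V i) \<le> emeasure (\<mu> x) (V i)"
            using V_sets[OF _ x, of UNIV] by (intro emeasure_mono) auto
          then have "emeasure (\<mu> x) (V i - (Pair x -` Q \<inter> V i)) = emeasure (\<mu> x) (V i) - emeasure (\<mu> x) (Pair x -` Q \<inter> V i)"
            using V_fin[OF x] V_sets[OF _ x, of UNIV] V_sets[OF sec[OF Q] x]
            by (intro emeasure_Diff) auto
          moreover have "V i - (Pair x -` Q \<inter> V i) = Pair x -` (- Q) \<inter> V i" by auto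
          ultimately show ?thesis by simp
        qed
        then show "?s i (space borel \<times> space borel - Q) x = (if x \<in> U i then emeasure (\<mu> x) (UNIV \<inter> V i) else 0) - ?s i Q x"
          by (auto simp: Compl_eq_Diff_UNIV)
      qed
      then show ?case using compl rect[of UNIV] by auto
    next
      case (union F)
      have F: "F j \<in> sets (borel \<Otimes>\<^sub>M borel)" for j using union(2) unfolding sets_pair_measure by auto
      have "?s i (\<Union>j. F j) = (\<lambda>x. \<Sum>j. ?s i (F j) x)"
      proof
        fix x
        have "emeasure (\<mu> x) (Pair x -` (\<Union>j. F j) \<inter> V i) = (\<Sum>j. emeasure (\<mu> x) (Pair x -` F j \<inter> V i))"
          if x: "x \<in> U i"
          using union(1) V_sets[OF sec[OF F] x]
          by (subst suminf_emeasure) (auto simp: disjoint_family_on_def vimage_UN intro!: arg_cong[where f="emeasure (\<mu> x)"])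
        then show "?s i (\<Union>j. F j) x = (\<Sum>j. ?s i (F j) x)" by auto
      qed
      then show ?case using union by auto
    qed
  qed
  \<comment> \<open>The cover becomes a partition, so that the masses of the pieces of a section add
    up.\<close>
  define D where "D = disjointed (\<lambda>i. U i \<times> V i)"
  have D_sets: "D i \<in> sets (borel \<Otimes>\<^sub>M borel)" for i
    unfolding D_def disjointed_def using U V by (intro sets.Diff sets.finite_UN pair_measureI) auto
  have D_sub: "D i \<subseteq> U i \<times> V i" for i unfolding D_def by (rule disjointed_subset)
  have D_un: "(\<Union>i. D i) = (\<Union>i. U i \<times> V i)" unfolding D_def by (rule UN_disjointed_eq)
  have D_disj: "disjoint_family D" unfolding D_def by (rule disjoint_family_disjointed)
  have "emeasure (\<mu> x) {y. y \<noteq> x \<and> (x, y) \<in> C} = (\<Sum>i. ?s i (C \<inter> D i) x)" for x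
  proof -
    have CD: "C \<inter> D i \<in> sets (borel \<Otimes>\<^sub>M borel)" for i using C D_sets by auto
    have "x \<notin> V i" if "x \<in> U i" for i using UV[of x i x] that d[of i] by auto
    then have eq: "{y. y \<noteq> x \<and> (x, y) \<in> C} = (\<Union>i. {y. y \<noteq> x \<and> (x, y) \<in> C \<inter> D i})"
      using cover[of x] D_un by (auto simp: set_eq_iff; blast)
    have "emeasure (\<mu> x) {y. y \<noteq> x \<and> (x, y) \<in> C} = (\<Sum>i. emeasure (\<mu> x) {y. y \<noteq> x \<and> (x, y) \<in> C \<inter> D i})"
      unfolding eq using D_disj section_sets[OF CD]
      by (subst suminf_emeasure) (auto simp: disjoint_family_on_def)
    also have "\<dots> = (\<Sum>i. ?s i (C \<inter> D i) x)"
    proof (rule suminf_cong)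
      fix i
      have "{y. y \<noteq> x \<and> (x, y) \<in> C \<inter> D i} = (if x \<in> U i then Pair x -` (C \<inter> D i) \<inter> V i else {})"
        using D_sub[of i] \<open>\<And>i. x \<in> U i \<Longrightarrow> x \<notin> V i\<close> by auto
      then show "emeasure (\<mu> x) {y. y \<noteq> x \<and> (x, y) \<in> C \<inter> D i} = ?s i (C \<inter> D i) x" by simp
    qed
    finally show ?thesis .
  qed
  then show ?thesis using loc C D_sets by simp
qed

section \<open>The jump measure on pairs, with Tonelli, Fubini and symmetry\<close>

text \<open>The condition \<open>y \<noteq> x\<close> gives the diagonal mass 0, so the measure can
  live on the whole product space with its usual Borel sets instead of on the off-diagonal
  subspace.\<close>

definition J :: "('a \<times> 'a) measure" where
  "J = measure_of UNIV (sets (borel \<Otimes>\<^sub>M borel))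
     (\<lambda>C. \<integral>\<^sup>+ x. emeasure (\<mu> x) {y. y \<noteq> x \<and> (x, y) \<in> C} \<partial>m)"

lemma sets_J [simp, measurable_cong]: "sets J = sets (borel \<Otimes>\<^sub>M borel)"
  unfolding J_def using sets.sigma_sets_eq[of "borel \<Otimes>\<^sub>M borel :: ('a \<times> 'a) measure"]
  by (simp add: space_pair_measure)

lemma space_J [simp]: "space J = UNIV"
  using sets_eq_imp_space_eq[OF sets_J] by (simp add: space_pair_measure)

lemma measurable_J [simp]: "measurable J N = measurable (borel \<Otimes>\<^sub>M borel) N"
  by (rule measurable_cong_sets) simp_all

lemma emeasure_J:
  assumes "C \<in> sets (borel \<Otimes>\<^sub>M borel)"
  shows "emeasure J C = (\<integral>\<^sup>+ x. emeasure (\<mu> x) {y. y \<noteq> x \<and> (x, y) \<in> C} \<partial>m)"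
proof (rule emeasure_measure_of[OF J_def])
  let ?e = "\<lambda>C. \<integral>\<^sup>+ x. emeasure (\<mu> x) {y. y \<noteq> x \<and> (x, y) \<in> C} \<partial>m"
  show "C \<in> sets J" using assms by simp
  show "positive (sets J) ?e" by (simp add: positive_def)
  show "countably_additive (sets J) ?e"
  proof (rule countably_additiveI)
    fix F :: "nat \<Rightarrow> ('a \<times> 'a) set"
    assume F: "range F \<subseteq> sets J" "disjoint_family F"
    then have Fi: "F i \<in> sets (borel \<Otimes>\<^sub>M borel)" for i by auto
    have eq: "(\<Sum>i. emeasure (\<mu> x) {y. y \<noteq> x \<and> (x, y) \<in> F i}) = emeasure (\<mu> x) {y. y \<noteq> x \<and> (x, y) \<in> (\<Union>i. F i)}" for x
      using F(2) section_sets[OF Fi]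
      by (subst suminf_emeasure) (auto simp: disjoint_family_on_def intro!: arg_cong[where f="emeasure (\<mu> x)"])
    have "(\<Sum>i. ?e (F i)) = (\<integral>\<^sup>+ x. (\<Sum>i. emeasure (\<mu> x) {y. y \<noteq> x \<and> (x, y) \<in> F i}) \<partial>m)"
      by (rule nn_integral_suminf[symmetric])
        (simp add: measurable_emeasure_section[OF Fi])
    then show "(\<Sum>i. ?e (F i)) = ?e (\<Union>i. F i)" by (simp only: eq)
  qed
qed simp

lemma measurable_kernel_section:
  "F \<in> measurable (borel \<Otimes>\<^sub>M borel) N \<Longrightarrow> (\<lambda>y. F (x, y)) \<in> measurable (\<mu> x) N"
  by (rule measurable_kernel) simp

text \<open>Both claims go through one induction over simple functions and monotone limits, because
  additivity and monotone convergence of the outer integral already need the inner integrals to be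
  measurable in \<open>x\<close>.\<close>

lemma nn_integral_J_aux:
  fixes F :: "'a \<times> 'a \<Rightarrow> ennreal"
  assumes "F \<in> borel_measurable (borel \<Otimes>\<^sub>M borel)"
  shows "(\<lambda>x. \<integral>\<^sup>+ y. F (x, y) \<partial>\<mu> x) \<in> borel_measurable borel \<and>
    (\<integral>\<^sup>+ z. F z \<partial>J) = (\<integral>\<^sup>+ x. \<integral>\<^sup>+ y. F (x, y) \<partial>\<mu> x \<partial>m)"
  using assms
proof (induction rule: borel_measurable_induct)
  case (cong f g)
  then have "f = g" by (auto simp: space_pair_measure)
  then show ?case using cong by simp
next
  case (set A)
  have "(\<integral>\<^sup>+ y. indicator A (x, y) \<partial>\<mu> x) = emeasure (\<mu> x) {y. y \<noteq> x \<and> (x, y) \<in> A}" for x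
    unfolding nn_integral_indicator[OF section_sets[OF set], symmetric]
    by (intro nn_integral_cong) (auto split: split_indicator)
  then show ?case using measurable_emeasure_section[OF set] set by (simp add: emeasure_J)
next
  case (mult u c)
  have "(\<integral>\<^sup>+ y. c * u (x, y) \<partial>\<mu> x) = c * (\<integral>\<^sup>+ y. u (x, y) \<partial>\<mu> x)" for x
    using mult by (intro nn_integral_cmult measurable_kernel_section)
  then show ?case using mult by (auto simp: nn_integral_cmult)
next
  case (add u v)
  have "(\<integral>\<^sup>+ y. v (x, y) + u (x, y) \<partial>\<mu> x) = (\<integral>\<^sup>+ y. v (x, y) \<partial>\<mu> x) + (\<integral>\<^sup>+ y. u (x, y) \<partial>\<mu> x)" for x
    using add by (intro nn_integral_add measurable_kernel_section)
  then show ?case using add by (auto simp: nn_integral_add)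
next
  case (seq U)
  have U: "U i \<in> borel_measurable (borel \<Otimes>\<^sub>M borel)" for i using seq by auto
  have inc: "incseq (\<lambda>i y. U i (x, y))" for x using \<open>incseq U\<close> by (auto simp: incseq_def le_fun_def)
  have eq: "(\<integral>\<^sup>+ y. (SUP i. U i) (x, y) \<partial>\<mu> x) = (SUP i. \<integral>\<^sup>+ y. U i (x, y) \<partial>\<mu> x)" for x
    using nn_integral_monotone_convergence_SUP[OF inc measurable_kernel_section[OF U]]
    by (simp add: image_comp)
  have inc2: "incseq (\<lambda>i x. \<integral>\<^sup>+ y. U i (x, y) \<partial>\<mu> x)"
    using \<open>incseq U\<close> by (auto simp: incseq_def le_fun_def intro!: nn_integral_mono)
  have "(\<integral>\<^sup>+ z. (SUP i. U i) z \<partial>J) = (SUP i. \<integral>\<^sup>+ z. U i z \<partial>J)"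
    using nn_integral_monotone_convergence_SUP[OF \<open>incseq U\<close>, of J] U by (simp add: image_comp)
  also have "\<dots> = (\<integral>\<^sup>+ x. (SUP i. \<integral>\<^sup>+ y. U i (x, y) \<partial>\<mu> x) \<partial>m)"
    using nn_integral_monotone_convergence_SUP[OF inc2, of m] seq by simp
  finally show ?case using seq eq by (auto simp: image_comp intro!: borel_measurable_SUP)
qed

lemma measurable_nn_integral_kernel:
  fixes F :: "'a \<times> 'a \<Rightarrow> ennreal"
  assumes "F \<in> borel_measurable (borel \<Otimes>\<^sub>M borel)"
  shows "(\<lambda>x. \<integral>\<^sup>+ y. F (x, y) \<partial>\<mu> x) \<in> borel_measurable borel"
  using nn_integral_J_aux[OF assms] by simp

lemma nn_integral_J:
  fixes F :: "'a \<times> 'a \<Rightarrow> ennreal"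
  assumes "F \<in> borel_measurable (borel \<Otimes>\<^sub>M borel)"
  shows "(\<integral>\<^sup>+ z. F z \<partial>J) = (\<integral>\<^sup>+ x. \<integral>\<^sup>+ y. F (x, y) \<partial>\<mu> x \<partial>m)"
  using nn_integral_J_aux[OF assms] by simp

lemma measurable_swap: "(prod.swap :: 'a \<times> 'a \<Rightarrow> 'a \<times> 'a) \<in> measurable (borel \<Otimes>\<^sub>M borel) (borel \<Otimes>\<^sub>M borel)"
  unfolding prod.swap_def by measurable

text \<open>The symmetry hypothesis covers only sets off the diagonal. It is applied to
  \<open>C\<close> with the diagonal removed, which leaves the punctured sections unchanged.\<close>

lemma distr_J_swap: "distr J (borel \<Otimes>\<^sub>M borel) prod.swap = J"
proof (rule measure_eqI)
  note measurable_swap[measurable]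
  fix C assume "C \<in> sets (distr J (borel \<Otimes>\<^sub>M borel) prod.swap)"
  then have C [measurable]: "C \<in> sets (borel \<Otimes>\<^sub>M borel)" by simp
  have "{z :: 'a \<times> 'a. fst z \<noteq> snd z} \<in> sets (borel \<Otimes>\<^sub>M borel)"
    unfolding borel_prod by (intro borel_open open_Collect_neq continuous_intros)
  then have "C \<inter> {z. fst z \<noteq> snd z} \<in> sets borel" using C unfolding borel_prod by (rule sets.Int[rotated])
  from symmetric[unfolded symmetric_kernel_def, rule_format, OF this]
  have sym: "(\<integral>\<^sup>+ x. emeasure (\<mu> x) {y. y \<noteq> x \<and> (x, y) \<in> C} \<partial>m) = (\<integral>\<^sup>+ x. emeasure (\<mu> x) {y. y \<noteq> x \<and> (y, x) \<in> C} \<partial>m)"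
    by (simp add: conj_commute eq_commute subset_eq split_beta')
  have "prod.swap -` C \<in> sets (borel \<Otimes>\<^sub>M borel)"
    using measurable_sets[OF measurable_swap C] by (simp add: space_pair_measure)
  then show "emeasure (distr J (borel \<Otimes>\<^sub>M borel) prod.swap) C = emeasure J C"
    using sym by (simp add: emeasure_distr emeasure_J)
qed simp

lemma nn_integral_J_swap:
  fixes F :: "'a \<times> 'a \<Rightarrow> ennreal"
  assumes "F \<in> borel_measurable (borel \<Otimes>\<^sub>M borel)"
  shows "(\<integral>\<^sup>+ z. F (prod.swap z) \<partial>J) = (\<integral>\<^sup>+ z. F z \<partial>J)"
  using nn_integral_distr[of prod.swap J "borel \<Otimes>\<^sub>M borel" F] assms measurable_swap
  by (simp add: distr_J_swap)

lemma integrable_J_swap: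
  fixes F :: "'a \<times> 'a \<Rightarrow> real"
  assumes "integrable J F"
  shows "integrable J (\<lambda>z. F (prod.swap z))" "(LINT z|J. F (prod.swap z)) = (LINT z|J. F z)"
  using assms measurable_swap borel_measurable_integrable[OF assms]
    integrable_distr_eq[of prod.swap J "borel \<Otimes>\<^sub>M borel" F] integral_distr[of prod.swap J "borel \<Otimes>\<^sub>M borel" F]
  by (simp_all add: distr_J_swap)

text \<open>Tonelli applied to \<open>\<bar>F\<bar>\<close> makes almost every section integrable;
  applied to the positive and negative parts it gives the integral as a difference of finite
  quantities.\<close>

lemma Fubini_J:
  fixes F :: "'a \<times> 'a \<Rightarrow> real"
  assumes F: "integrable J F"
  shows "AE x in m. integrable (\<mu> x) (\<lambda>y. F (x, y))"
    and "integrable m (\<lambda>x. LINT y|\<mu> x. F (x, y))"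
    and "(LINT z|J. F z) = (LINT x|m. LINT y|\<mu> x. F (x, y))"
proof -
  have Fm [measurable]: "F \<in> borel_measurable (borel \<Otimes>\<^sub>M borel)"
    using borel_measurable_integrable[OF F] by simp
  have sec [simp]: "(\<lambda>y. F (x, y)) \<in> borel_measurable (\<mu> x)" for x
    by (rule measurable_kernel_section) simp
  define A where "A x = (\<integral>\<^sup>+ y. ennreal \<bar>F (x, y)\<bar> \<partial>\<mu> x)" for x
  define P where "P x = (\<integral>\<^sup>+ y. ennreal (F (x, y)) \<partial>\<mu> x)" for x
  define N where "N x = (\<integral>\<^sup>+ y. ennreal (- F (x, y)) \<partial>\<mu> x)" for x
  have [measurable]: "A \<in> borel_measurable borel" "P \<in> borel_measurable borel" "N \<in> borel_measurable borel"
    unfolding A_def P_def N_def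
    using measurable_nn_integral_kernel[of "\<lambda>z. ennreal \<bar>F z\<bar>"] measurable_nn_integral_kernel[of "\<lambda>z. ennreal (F z)"]
      measurable_nn_integral_kernel[of "\<lambda>z. ennreal (- F z)"] by measurable
  have PA: "P x \<le> A x" "N x \<le> A x" for x
    unfolding A_def P_def N_def by (auto intro!: nn_integral_mono ennreal_leI)
  have intA: "(\<integral>\<^sup>+ x. A x \<partial>m) < \<infinity>"
    using F nn_integral_J[of "\<lambda>z. ennreal \<bar>F z\<bar>"] by (simp add: integrable_iff_bounded A_def)
  then have A_fin: "AE x in m. A x < \<infinity>"
    using nn_integral_PInf_AE[of A m] by (auto simp: less_top)
  have int_iff: "integrable (\<mu> x) (\<lambda>y. F (x, y)) \<longleftrightarrow> A x < \<infinity>" for x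
    by (simp add: integrable_iff_bounded A_def)
  show "AE x in m. integrable (\<mu> x) (\<lambda>y. F (x, y))" using A_fin by (simp add: int_iff)
  \<comment> \<open>A section that is not integrable has Bochner integral 0 by convention, so this
    formula holds at every \<open>x\<close> and shows measurability of the left side.\<close>
  have L_eq: "(LINT y|\<mu> x. F (x, y)) = (if A x < \<infinity> then enn2real (P x) - enn2real (N x) else 0)" for x
    using int_iff[of x] by (auto simp: P_def N_def real_lebesgue_integral_def not_integrable_integral_eq)
  have [measurable]: "(\<lambda>x. LINT y|\<mu> x. F (x, y)) \<in> borel_measurable borel"
    unfolding L_eq by measurable
  \<comment> \<open>Here \<open>Q\<close> stands for \<open>P\<close> or \<open>N\<close>. Passing
    through \<open>enn2real\<close> alters \<open>Q\<close> only where it is infinite, which is a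
    null set because \<open>Q\<close> is below \<open>A\<close>.\<close>
  have intPN: "integrable m (\<lambda>x. enn2real (Q x)) \<and> (LINT x|m. enn2real (Q x)) = enn2real (\<integral>\<^sup>+ x. Q x \<partial>m)"
    if [measurable]: "Q \<in> borel_measurable borel" and QA: "\<And>x. Q x \<le> A x" for Q
  proof -
    have "(\<integral>\<^sup>+ x. ennreal (enn2real (Q x)) \<partial>m) = (\<integral>\<^sup>+ x. Q x \<partial>m)"
      using A_fin by (intro nn_integral_cong_AE, eventually_elim) (metis QA ennreal_enn2real infinity_ennreal_def le_less_trans)
    moreover have "(\<integral>\<^sup>+ x. Q x \<partial>m) < \<infinity>"
      using nn_integral_mono[of m Q A] QA intA by (auto intro: le_less_trans)
    ultimately show ?thesis
      by (auto simp: integrable_iff_bounded integral_eq_nn_integral)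
  qed
  have L_AE: "AE x in m. (LINT y|\<mu> x. F (x, y)) = enn2real (P x) - enn2real (N x)"
    using A_fin by eventually_elim (simp add: L_eq)
  have PN: "integrable m (\<lambda>x. enn2real (P x) - enn2real (N x))"
    using intPN[of P] intPN[of N] PA by (intro Bochner_Integration.integrable_diff) auto
  show "integrable m (\<lambda>x. LINT y|\<mu> x. F (x, y))"
    by (rule integrable_cong_AE_imp[OF PN]) (use L_AE in auto)
  have "(LINT x|m. LINT y|\<mu> x. F (x, y)) = (LINT x|m. enn2real (P x) - enn2real (N x))"
    using L_AE by (intro integral_cong_AE) auto
  also have "\<dots> = enn2real (\<integral>\<^sup>+ x. P x \<partial>m) - enn2real (\<integral>\<^sup>+ x. N x \<partial>m)"
    using intPN[of P] intPN[of N] PA by (subst Bochner_Integration.integral_diff) auto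
  also have "\<dots> = (LINT z|J. F z)"
    using nn_integral_J[of "\<lambda>z. ennreal (F z)"] nn_integral_J[of "\<lambda>z. ennreal (- F z)"] F
    by (simp add: real_lebesgue_integral_def P_def N_def)
  finally show "(LINT z|J. F z) = (LINT x|m. LINT y|\<mu> x. F (x, y))" ..
qed

text \<open>An \<open>m\<close>-null set of first coordinates is \<open>J\<close>-null by Tonelli,
  and for second coordinates by symmetry. Thus differences of functions at two points respect
  equality and convergence almost everywhere.\<close>

lemma AE_J:
  assumes "AE x in m. P x"
  shows "AE z in J. P (fst z) \<and> P (snd z)"
proof -
  obtain N where N [measurable]: "N \<in> sets borel" and N0: "emeasure m N = 0" and NP: "\<And>x. \<not> P x \<Longrightarrow> x \<in> N"
    using assms by (elim AE_E) (force intro: that)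
  have *: "(\<lambda>z. indicator N (fst z) :: ennreal) \<in> borel_measurable (borel \<Otimes>\<^sub>M borel)" by measurable
  have "AE x in m. x \<notin> N" using N0 N by (intro AE_not_in) (auto simp: null_sets_def)
  then have "(\<integral>\<^sup>+ x. \<integral>\<^sup>+ y. indicator N x \<partial>\<mu> x \<partial>m) = (\<integral>\<^sup>+ x. 0 \<partial>m)"
    by (intro nn_integral_cong_AE) (auto elim!: eventually_mono)
  then have 0: "(\<integral>\<^sup>+ z. indicator N (fst z) \<partial>J) = 0"
    using nn_integral_J[OF *] by simp
  then have 1: "AE z in J. indicator N (fst z) = (0::ennreal)"
    using * by (simp add: nn_integral_0_iff_AE)
  have "(\<integral>\<^sup>+ z. indicator N (snd z) \<partial>J) = 0"
    using nn_integral_J_swap[OF *] 0 by simp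
  then have 2: "AE z in J. indicator N (snd z) = (0::ennreal)"
    by (subst (asm) nn_integral_0_iff_AE) auto
  show ?thesis using 1 2 by eventually_elim (auto simp: indicator_eq_0_iff intro: ccontr dest: NP)
qed

section \<open>Integrability against the jump weight\<close>

abbreviation w :: "'a \<times> 'a \<Rightarrow> real" where
  "w z \<equiv> min 1 ((dist (fst z) (snd z))\<^sup>2)"

lemma measurable_dist_pair [measurable]:
  "(\<lambda>z::'a \<times> 'a. dist (fst z) (snd z)) \<in> borel_measurable (borel \<Otimes>\<^sub>M borel)"
  unfolding borel_prod by (intro borel_measurable_continuous_onI continuous_intros)

text \<open>Integrating out the second variable costs at most the factor \<open>M\<close>, uniformly
  in the first; the other variable is handled by the swap. All later majorants that are not energies
  are built from these functions.\<close>

lemma integrable_weight: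
  fixes \<phi> :: "'a \<Rightarrow> real"
  assumes "integrable m \<phi>"
  shows "integrable J (\<lambda>z. \<phi> (fst z) * w z)" "integrable J (\<lambda>z. \<phi> (snd z) * w z)"
proof -
  have [measurable]: "\<phi> \<in> borel_measurable borel" using borel_measurable_integrable[OF assms] by simp
  have *: "(\<lambda>z. ennreal (norm (\<phi> (fst z) * w z))) \<in> borel_measurable (borel \<Otimes>\<^sub>M borel)" by measurable
  have w_sec: "(\<lambda>y. ennreal (min 1 ((dist x y)\<^sup>2))) \<in> borel_measurable (\<mu> x)" for x
    by (rule measurable_kernel) (intro measurable_compose[OF _ measurable_ennreal] borel_measurable_continuous_onI continuous_intros)
  have "(\<integral>\<^sup>+ z. ennreal (norm (\<phi> (fst z) * w z)) \<partial>J)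
      = (\<integral>\<^sup>+ x. ennreal \<bar>\<phi> x\<bar> * (\<integral>\<^sup>+ y. ennreal (min 1 ((dist x y)\<^sup>2)) \<partial>\<mu> x) \<partial>m)"
    using nn_integral_J[OF *] by (simp add: abs_mult ennreal_mult' nn_integral_cmult[OF w_sec])
  also have "\<dots> \<le> (\<integral>\<^sup>+ x. ennreal \<bar>\<phi> x\<bar> * M \<partial>m)"
    by (intro nn_integral_mono mult_left_mono moment) auto
  also have "\<dots> = (\<integral>\<^sup>+ x. ennreal \<bar>\<phi> x\<bar> \<partial>m) * M"
    by (rule nn_integral_multc) simp
  also have "\<dots> < \<infinity>"
    using assms M_finite by (simp add: integrable_iff_bounded ennreal_mult_less_top)
  finally show 1: "integrable J (\<lambda>z. \<phi> (fst z) * w z)"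
    by (intro integrableI_bounded) simp_all
  show "integrable J (\<lambda>z. \<phi> (snd z) * w z)"
    using integrable_J_swap(1)[OF 1] by (simp add: dist_commute)
qed

end

section \<open>Test functions, integrability exponents and Young's inequality\<close>

lemma lip_compact_supportE:
  assumes "h \<in> lip_compact_support"
  obtains C \<rho> where "C \<ge> 0" "\<And>x. \<bar>h x\<bar> \<le> C" "\<And>x y. \<bar>h x - h y\<bar> \<le> C * dist x y"
    "\<And>x. h x \<noteq> 0 \<Longrightarrow> x \<in> ball 0 \<rho>" "h \<in> borel_measurable borel"
proof -
  obtain L where L: "L-lipschitz_on UNIV h" and K: "compact (closure {x. h x \<noteq> 0})"
    using assms by (auto simp: lip_compact_support_def)
  have cont: "continuous_on UNIV h" using L by (rule lipschitz_on_continuous_on)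
  obtain \<rho> where \<rho>: "closure {x. h x \<noteq> 0} \<subseteq> ball 0 \<rho>"
    using bounded_subset_ballD[OF compact_imp_bounded[OF K]] by blast
  have "bounded (h ` closure {x. h x \<noteq> 0})"
    using K cont by (intro compact_imp_bounded compact_continuous_image) (auto intro: continuous_on_subset)
  then obtain H where H: "\<And>x. x \<in> closure {x. h x \<noteq> 0} \<Longrightarrow> \<bar>h x\<bar> \<le> H"
    by (auto simp: bounded_iff)
  have supp: "x \<in> closure {x. h x \<noteq> 0}" if "h x \<noteq> 0" for x
    using that closure_subset[of "{x. h x \<noteq> 0}"] by auto
  show thesis
  proof (rule that[of "max L (max H 0)" \<rho>])
    show "\<bar>h x\<bar> \<le> max L (max H 0)" for x using H[of x] supp[of x] by (cases "h x = 0") auto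
    show "\<bar>h x - h y\<bar> \<le> max L (max H 0) * dist x y" for x y
      using lipschitz_onD[OF L, of x y] mult_right_mono[of L "max L (max H 0)" "dist x y"]
      by (simp add: dist_real_def)
    show "x \<in> ball 0 \<rho>" if "h x \<noteq> 0" for x using supp[OF that] \<rho> by auto
  qed (auto intro: borel_measurable_continuous_onI cont)
qed

lemma Lp_space_real:
  "0 \<le> p \<Longrightarrow> f \<in> Lp_space (ennreal p) m \<longleftrightarrow> f \<in> borel_measurable m \<and> integrable m (\<lambda>x. \<bar>f x\<bar> powr p)"
  by (auto simp: Lp_space_def)

lemma Lp_space_2: "f \<in> Lp_space 2 m \<longleftrightarrow> f \<in> borel_measurable m \<and> integrable m (\<lambda>x. (f x)\<^sup>2)"
  using Lp_space_real[of 2 f m] by (simp add: powr_numeral flip: ennreal_numeral)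

lemma integrable_square_diff:
  fixes f g :: "'b \<Rightarrow> real"
  assumes [measurable]: "f \<in> borel_measurable N" "g \<in> borel_measurable N"
    and "integrable N (\<lambda>x. (f x)\<^sup>2)" "integrable N (\<lambda>x. (g x)\<^sup>2)"
  shows "integrable N (\<lambda>x. (f x - g x)\<^sup>2)"
proof (rule Bochner_Integration.integrable_bound)
  show "integrable N (\<lambda>x. 2 * (f x)\<^sup>2 + 2 * (g x)\<^sup>2)" using assms by auto
  have "(a - b)\<^sup>2 \<le> 2 * a\<^sup>2 + 2 * b\<^sup>2" for a b :: real
    using zero_le_power2[of "a + b"] by (simp add: power2_eq_square algebra_simps)
  then show "AE x in N. norm ((f x - g x)\<^sup>2) \<le> norm (2 * (f x)\<^sup>2 + 2 * (g x)\<^sup>2)" by simp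
qed measurable

text \<open>This is what the conjugate exponents supply for long jumps, where \<open>f\<close> and
  \<open>g\<close> are evaluated at different points. The bound in \<open>g\<close> is required only
  almost everywhere, since for an infinite exponent \<open>g\<close> is only essentially
  bounded.\<close>

definition product_dominated :: "'a measure \<Rightarrow> ('a \<Rightarrow> real) \<Rightarrow> ('a \<Rightarrow> real) \<Rightarrow> bool" where
  "product_dominated m f g \<longleftrightarrow> (\<exists>\<phi> \<psi>. integrable m \<phi> \<and> integrable m \<psi> \<and>
     (\<forall>x. 0 \<le> \<phi> x) \<and> (\<forall>x. 0 \<le> \<psi> x) \<and> (AE x in m. \<forall>y. \<bar>f y\<bar> * \<bar>g x\<bar> \<le> \<phi> y + \<psi> x))"

text \<open>For finite \<open>q\<close> this is Young's inequality. For
  \<open>q = \<infinity>\<close> the exponent \<open>p\<close> is 1, and the essential bound of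
  \<open>g\<close> times \<open>\<bar>f\<bar>\<close> dominates.\<close>

lemma product_dominated_Lp:
  assumes p: "1 \<le> p" and pq: "1 / ennreal p + 1 / q = 1"
    and f: "f \<in> Lp_space (ennreal p) m" and g: "g \<in> Lp_space q m"
  shows "product_dominated m f g"
proof (cases "q = \<infinity>")
  case True
  then have "ennreal (1 / p) = ennreal 1" using pq p by (simp add: divide_ennreal flip: ennreal_1)
  then have [simp]: "p = 1" using p by (simp add: ennreal_inj)
  have f1: "integrable m (\<lambda>x. \<bar>f x\<bar>)" using f Lp_space_real[of 1 f m] by simp
  have ess: "esssup m (\<lambda>x. ennreal \<bar>g x\<bar>) < \<infinity>" using g True by (simp add: Lp_space_def)
  define G where "G = enn2real (esssup m (\<lambda>x. ennreal \<bar>g x\<bar>))"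
  have "AE x in m. ennreal \<bar>g x\<bar> \<le> ennreal G"
    using esssup_AE[of "\<lambda>x. ennreal \<bar>g x\<bar>" m] ess by (simp add: G_def ennreal_enn2real_if)
  then have "AE x in m. \<forall>y. \<bar>f y\<bar> * \<bar>g x\<bar> \<le> G * \<bar>f y\<bar> + 0"
    by eventually_elim (auto simp: G_def mult.commute[of _ "\<bar>f _\<bar>"] intro!: mult_left_mono)
  moreover have "0 \<le> G" by (simp add: G_def)
  ultimately show ?thesis
    unfolding product_dominated_def using f1
    by (intro exI[of _ "\<lambda>y. G * \<bar>f y\<bar>"] exI[of _ "\<lambda>_. 0"]) auto
next
  case False
  then obtain r where r: "q = ennreal r" "0 \<le> r" by (cases q) auto
  \<comment> \<open>In \<open>ennreal\<close> the quotient \<open>1 / 0\<close> is infinite, so a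
    zero exponent would contradict the sum being 1.\<close>
  have "r \<noteq> 0" using pq r by (auto simp: ennreal_divide_eq_top_iff)
  with r have r0: "r > 0" by simp
  have "ennreal (1 / p + 1 / r) = ennreal 1"
    using pq p r r0 by (simp add: divide_ennreal flip: ennreal_1 ennreal_plus)
  then have pr: "1 / p + 1 / r = 1" using p r0 by (subst (asm) ennreal_inj) auto
  have "p \<noteq> 1" using pr r0 by auto
  moreover have "r > 1"
  proof (rule ccontr)
    assume "\<not> r > 1"
    then have "1 / r \<ge> 1" using r0 by simp
    moreover have "1 / p > 0" using p by simp
    ultimately show False using pr by linarith
  qed
  ultimately have "\<bar>f y\<bar> * \<bar>g x\<bar> \<le> \<bar>f y\<bar> powr p / p + \<bar>g x\<bar> powr r / r" for x y
    using p pr by (intro Youngs_inequality) auto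
  then show ?thesis
    unfolding product_dominated_def using f g p r r0
    by (intro exI[of _ "\<lambda>y. \<bar>f y\<bar> powr p / p"] exI[of _ "\<lambda>x. \<bar>g x\<bar> powr r / r"]) (auto simp: Lp_space_real)
qed

context symmetric_jump begin

section \<open>Finite energy of test functions and of the form domain\<close>

abbreviation \<Delta> :: "('a \<Rightarrow> real) \<Rightarrow> 'a \<times> 'a \<Rightarrow> real" where
  "\<Delta> u z \<equiv> u (fst z) - u (snd z)"

lemma emeasure_ball_finite: "emeasure m (ball x r) < \<infinity>"
proof -
  have "emeasure m (ball x r) \<le> emeasure m (cball x r)" by (intro emeasure_mono) auto
  also have "\<dots> < \<infinity>" using radon by (simp add: radon_measure_def)
  finally show ?thesis .
qed

lemma integrable_indicator_ball: "integrable m (indicator (ball x r) :: 'a \<Rightarrow> real)"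
  using emeasure_ball_finite[of x r] by (intro integrable_real_indicator) auto

text \<open>The Lipschitz bound near the diagonal and the bound \<open>2 * C\<close> away from it
  combine to \<open>(2 * C)\<^sup>2 * w z\<close>. The increment vanishes unless one of the two
  points lies in a ball of finite \<open>m\<close>-measure, so the weight lemma applies.\<close>

lemma lip_compact_support_integrable:
  assumes "h \<in> lip_compact_support"
  shows "integrable m h" "integrable m (\<lambda>x. (h x)\<^sup>2)" "integrable J (\<lambda>z. (\<Delta> h z)\<^sup>2)"
proof -
  obtain C \<rho> where C: "C \<ge> 0" "\<And>x. \<bar>h x\<bar> \<le> C" "\<And>x y. \<bar>h x - h y\<bar> \<le> C * dist x y"
    "\<And>x. h x \<noteq> 0 \<Longrightarrow> x \<in> ball 0 \<rho>" and [measurable]: "h \<in> borel_measurable borel"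
    by (rule lip_compact_supportE[OF assms]) (rule that)
  show "integrable m h"
    using C(2,4) emeasure_ball_finite[of 0 \<rho>] by (intro integrableI_bounded_set[of "ball 0 \<rho>" _ _ C]) auto
  show "integrable m (\<lambda>x. (h x)\<^sup>2)"
    using C(2,4) power_mono[OF C(2), where n=2] emeasure_ball_finite[of 0 \<rho>]
    by (intro integrableI_bounded_set[of "ball 0 \<rho>" _ _ "C\<^sup>2"]) auto
  let ?i = "indicator (ball 0 \<rho>) :: 'a \<Rightarrow> real"
  show "integrable J (\<lambda>z. (\<Delta> h z)\<^sup>2)"
  proof (rule Bochner_Integration.integrable_bound)
    show "integrable J (\<lambda>z. (2 * C)\<^sup>2 * (?i (fst z) * w z + ?i (snd z) * w z))"
      using integrable_weight[OF integrable_indicator_ball[of 0 \<rho>]] by (intro integrable_mult_right Bochner_Integration.integrable_add)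
    have "(\<Delta> h z)\<^sup>2 \<le> (2 * C)\<^sup>2 * (?i (fst z) * w z + ?i (snd z) * w z)" for z
    proof (cases "\<Delta> h z = 0")
      case False
      have "\<bar>\<Delta> h z\<bar> \<le> 2 * C * dist (fst z) (snd z)"
        using C(1) C(3)[of "fst z" "snd z"] mult_nonneg_nonneg[OF C(1) zero_le_dist[of "fst z" "snd z"]] by linarith
      moreover have "\<bar>\<Delta> h z\<bar> \<le> 2 * C" using C(2)[of "fst z"] C(2)[of "snd z"] by linarith
      ultimately have "(\<Delta> h z)\<^sup>2 \<le> (2 * C)\<^sup>2 * (dist (fst z) (snd z))\<^sup>2" "(\<Delta> h z)\<^sup>2 \<le> (2 * C)\<^sup>2"
        using power_mono[of "\<bar>\<Delta> h z\<bar>" "2 * C * dist (fst z) (snd z)" 2] power_mono[of "\<bar>\<Delta> h z\<bar>" "2 * C" 2]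
        by (simp_all add: power_mult_distrib)
      then have "(\<Delta> h z)\<^sup>2 \<le> (2 * C)\<^sup>2 * w z" by (simp add: min_def)
      also have "\<dots> \<le> (2 * C)\<^sup>2 * (?i (fst z) * w z + ?i (snd z) * w z)"
      proof -
        have "fst z \<in> ball 0 \<rho> \<or> snd z \<in> ball 0 \<rho>"
          using C(4)[of "fst z"] C(4)[of "snd z"] False by (cases "h (fst z) = 0") auto
        then have "1 \<le> ?i (fst z) + ?i (snd z)" by (auto split: split_indicator)
        then have "1 * w z \<le> (?i (fst z) + ?i (snd z)) * w z" by (intro mult_right_mono) auto
        then show ?thesis by (intro mult_left_mono) (auto simp: distrib_right)
      qed
      finally show ?thesis .
    qed simp
    then show "AE z in J. norm ((\<Delta> h z)\<^sup>2) \<le> norm ((2 * C)\<^sup>2 * (?i (fst z) * w z + ?i (snd z) * w z))"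
      by (auto intro: order_trans[OF _ abs_ge_self])
  qed simp
qed

lemma energy_form_eq:
  assumes "integrable J (\<lambda>z. (\<Delta> u z)\<^sup>2)"
  shows "energy_form \<mu> m u u = (LINT z|J. (\<Delta> u z)\<^sup>2)"
  using Fubini_J(3)[OF assms] by (simp add: energy_form_def power2_eq_square)

text \<open>A Cauchy sequence in the energy norm has bounded energies, and lower semicontinuity
  passes the bound on to the limit.\<close>

lemma form_domain_integrable:
  assumes "f \<in> form_domain \<mu> m"
  shows "f \<in> borel_measurable borel" "integrable m (\<lambda>x. (f x)\<^sup>2)" "integrable J (\<lambda>z. (\<Delta> f z)\<^sup>2)"
proof -
  obtain u where u: "\<And>n. u n \<in> lip_compact_support"
    and Cauchy: "\<And>e. e > 0 \<Longrightarrow> \<exists>N. \<forall>j\<ge>N. \<forall>k\<ge>N. energy_norm \<mu> m (\<lambda>x. u j x - u k x) < e"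
    and L2: "(\<lambda>n. LINT x|m. (u n x - f x)\<^sup>2) \<longlonglongrightarrow> 0"
    and f: "f \<in> Lp_space 2 m"
    using assms by (auto simp: form_domain_def)
  show f_meas [measurable]: "f \<in> borel_measurable borel" and f2: "integrable m (\<lambda>x. (f x)\<^sup>2)"
    using f by (auto simp: Lp_space_2)
  have u_meas [measurable]: "u n \<in> borel_measurable borel" for n
    using lip_compact_supportE[OF u[of n]] by blast
  note u_int = lip_compact_support_integrable[OF u]
  obtain N where N: "\<And>k. k \<ge> N \<Longrightarrow> energy_norm \<mu> m (\<lambda>x. u N x - u k x) < 1"
    using Cauchy[of 1] by auto
  \<comment> \<open>From \<open>b\<^sup>2 \<le> 2 * a\<^sup>2 + 2 * (a - b)\<^sup>2\<close> with the
    increments of \<open>u N\<close> and \<open>u k\<close>, whose difference has energy at most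
    1.\<close>
  define B where "B = 2 * (LINT z|J. (\<Delta> (u N) z)\<^sup>2) + 2"
  have B: "(LINT z|J. (\<Delta> (u k) z)\<^sup>2) \<le> B" if k: "k \<ge> N" for k
  proof -
    have d: "integrable J (\<lambda>z. (\<Delta> (\<lambda>x. u N x - u k x) z)\<^sup>2)"
      using integrable_square_diff[of "\<Delta> (u N)" J "\<Delta> (u k)"] u_int by (simp add: algebra_simps)
    have "sqrt ((LINT z|J. (\<Delta> (\<lambda>x. u N x - u k x) z)\<^sup>2) + (LINT x|m. (u N x - u k x)\<^sup>2)) < 1"
      using N[OF k] by (simp add: energy_norm_def energy_form_eq[OF d])
    then have "(LINT z|J. (\<Delta> (\<lambda>x. u N x - u k x) z)\<^sup>2) + (LINT x|m. (u N x - u k x)\<^sup>2) < 1"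
      by simp
    moreover have "(LINT x|m. (u N x - u k x)\<^sup>2) \<ge> 0" by simp
    ultimately have 1: "(LINT z|J. (\<Delta> (\<lambda>x. u N x - u k x) z)\<^sup>2) \<le> 1" by linarith
    have sq: "b\<^sup>2 \<le> 2 * a\<^sup>2 + 2 * (a - b)\<^sup>2" for a b :: real
      using zero_le_power2[of "2 * a - b"] by (simp add: power2_eq_square algebra_simps)
    have "(LINT z|J. (\<Delta> (u k) z)\<^sup>2) \<le> (LINT z|J. 2 * (\<Delta> (u N) z)\<^sup>2 + 2 * (\<Delta> (\<lambda>x. u N x - u k x) z)\<^sup>2)"
    proof (rule integral_mono)
      show "(\<Delta> (u k) z)\<^sup>2 \<le> 2 * (\<Delta> (u N) z)\<^sup>2 + 2 * (\<Delta> (\<lambda>x. u N x - u k x) z)\<^sup>2" for z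
        using sq[of "\<Delta> (u k) z" "\<Delta> (u N) z"] by (simp add: algebra_simps)
      show "integrable J (\<lambda>z. (\<Delta> (u k) z)\<^sup>2)" by (rule u_int(3))
      show "integrable J (\<lambda>z. 2 * (\<Delta> (u N) z)\<^sup>2 + 2 * (\<Delta> (\<lambda>x. u N x - u k x) z)\<^sup>2)"
        using u_int(3)[of N] d by (intro Bochner_Integration.integrable_add integrable_mult_right)
    qed
    also have "\<dots> = 2 * (LINT z|J. (\<Delta> (u N) z)\<^sup>2) + 2 * (LINT z|J. (\<Delta> (\<lambda>x. u N x - u k x) z)\<^sup>2)"
      using u_int(3)[of N] d
      by (subst Bochner_Integration.integral_add) (auto simp del: right_diff_distrib_numeral)
    finally show ?thesis using 1 by (simp add: B_def)
  qed
  \<comment> \<open>Convergence in L^2 is L^1 convergence of the squared errors, which gives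
    convergence almost everywhere along a subsequence.\<close>
  obtain r :: "nat \<Rightarrow> nat" where r: "strict_mono r" "AE x in m. (\<lambda>n. (u (r n) x - f x)\<^sup>2) \<longlonglongrightarrow> 0"
    using tendsto_L1_AE_subseq[of m "\<lambda>n x. (u n x - f x)\<^sup>2"] L2 integrable_square_diff[of "u _" m f] u_int f2
    by auto
  \<comment> \<open>Fatou along an almost everywhere convergent subsequence.\<close>
  have "AE z in J. (\<lambda>n. (\<Delta> (u (r n)) z)\<^sup>2) \<longlonglongrightarrow> (\<Delta> f z)\<^sup>2"
    using AE_J[OF r(2)]
  proof eventually_elim
    case (elim z)
    have "(\<lambda>n. u (r n) x) \<longlonglongrightarrow> f x" if "(\<lambda>n. (u (r n) x - f x)\<^sup>2) \<longlonglongrightarrow> 0" for x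
      using tendsto_real_sqrt[OF that] by (simp add: tendsto_rabs_zero_iff Lim_null[symmetric])
    then show ?case using elim by (intro tendsto_intros) auto
  qed
  then have "(\<integral>\<^sup>+ z. ennreal ((\<Delta> f z)\<^sup>2) \<partial>J) = (\<integral>\<^sup>+ z. liminf (\<lambda>n. ennreal ((\<Delta> (u (r n)) z)\<^sup>2)) \<partial>J)"
    by (intro nn_integral_cong_AE, eventually_elim)
      (intro lim_imp_Liminf[symmetric] tendsto_ennrealI sequentially_bot)
  also have "\<dots> \<le> liminf (\<lambda>n. \<integral>\<^sup>+ z. ennreal ((\<Delta> (u (r n)) z)\<^sup>2) \<partial>J)"
    by (intro nn_integral_liminf) simp
  also have "\<dots> \<le> ennreal B"
  proof (rule Liminf_le)
    show "\<forall>\<^sub>F n in sequentially. (\<integral>\<^sup>+ z. ennreal ((\<Delta> (u (r n)) z)\<^sup>2) \<partial>J) \<le> ennreal B"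
      using eventually_ge_at_top[of N]
    proof eventually_elim
      case (elim n)
      then have "r n \<ge> N" using seq_suble[OF r(1), of n] by simp
      then show ?case using B[of "r n"] u_int(3)[of "r n"] by (subst nn_integral_eq_integral) (auto intro!: ennreal_leI)
    qed
  qed simp
  finally have "(\<integral>\<^sup>+ z. ennreal ((\<Delta> f z)\<^sup>2) \<partial>J) < \<infinity>" by (rule le_less_trans) simp
  then show "integrable J (\<lambda>z. (\<Delta> f z)\<^sup>2)" by (intro integrableI_nonneg) auto
qed

text \<open>The energy is cut off in both variables, because a function in the local domain is
  controlled by a member of the form domain only while both points stay in the ball.\<close>

definition locally_finite_energy :: "('a \<Rightarrow> real) \<Rightarrow> bool" where
  "locally_finite_energy f \<longleftrightarrow> f \<in> borel_measurable borel \<and>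
     (\<forall>\<rho>. integrable m (\<lambda>x. indicator (ball 0 \<rho>) x * (f x)\<^sup>2) \<and>
       integrable J (\<lambda>z. indicator (ball 0 \<rho> \<times> ball 0 \<rho>) z * (\<Delta> f z)\<^sup>2))"

lemma locally_finite_energy_local:
  assumes "f \<in> local_form_domain \<mu> m"
  shows "locally_finite_energy f"
  unfolding locally_finite_energy_def
proof (intro conjI allI)
  show f_meas: "f \<in> borel_measurable borel" using assms by (simp add: local_form_domain_def)
  note [measurable] = f_meas
  fix \<rho> :: real
  let ?B = "ball (0::'a) \<rho>"
  have [measurable]: "?B \<in> sets borel" by simp
  have BB [measurable]: "?B \<times> ?B \<in> sets (borel \<Otimes>\<^sub>M borel)" by (intro pair_measureI) auto
  have "compact (closure ?B)" by (simp add: compact_closure)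
  then obtain g where g: "g \<in> form_domain \<mu> m" and eq: "AE x in m. x \<in> ?B \<longrightarrow> f x = g x"
    using assms unfolding local_form_domain_def by blast
  note g_int = form_domain_integrable[OF g]
  have "integrable m (\<lambda>x. indicator ?B x * (g x)\<^sup>2)"
    using integrable_real_mult_indicator[OF _ g_int(2), of ?B] by (simp add: mult.commute)
  then show "integrable m (\<lambda>x. indicator ?B x * (f x)\<^sup>2)"
  proof (rule integrable_cong_AE_imp)
    show "(\<lambda>x. indicator ?B x * (f x)\<^sup>2) \<in> borel_measurable m" unfolding measurable_m by measurable
    show "AE x in m. indicator ?B x * (g x)\<^sup>2 = indicator ?B x * (f x)\<^sup>2"
      using eq by eventually_elim (auto split: split_indicator)
  qed
  have "integrable J (\<lambda>z. indicator (?B \<times> ?B) z * (\<Delta> g z)\<^sup>2)"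
    using integrable_real_mult_indicator[OF _ g_int(3), of "?B \<times> ?B"] BB by (simp add: mult.commute)
  then show "integrable J (\<lambda>z. indicator (?B \<times> ?B) z * (\<Delta> f z)\<^sup>2)"
  proof (rule integrable_cong_AE_imp)
    show "(\<lambda>z. indicator (?B \<times> ?B) z * (\<Delta> f z)\<^sup>2) \<in> borel_measurable J" unfolding measurable_J by measurable
    show "AE z in J. indicator (?B \<times> ?B) z * (\<Delta> g z)\<^sup>2 = indicator (?B \<times> ?B) z * (\<Delta> f z)\<^sup>2"
      using AE_J[OF eq] by eventually_elim (auto split: split_indicator)
  qed
qed

text \<open>This allows \<open>h\<close> to take the place of \<open>g\<close> when the existence of
  the carre du champ of \<open>f\<close> and \<open>h\<close> is shown.\<close>

lemma locally_finite_energy_lip: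
  assumes h: "h \<in> lip_compact_support"
  shows "locally_finite_energy h"
  unfolding locally_finite_energy_def
proof (intro conjI allI)
  show "h \<in> borel_measurable borel" using lip_compact_supportE[OF h] by blast
  note h_int = lip_compact_support_integrable[OF h]
  fix \<rho> :: real
  have "ball 0 \<rho> \<times> ball 0 \<rho> \<in> sets (borel \<Otimes>\<^sub>M borel :: ('a \<times> 'a) measure)" by (intro pair_measureI) auto
  then show "integrable m (\<lambda>x. indicator (ball 0 \<rho>) x * (h x)\<^sup>2)"
    "integrable J (\<lambda>z. indicator (ball 0 \<rho> \<times> ball 0 \<rho>) z * (\<Delta> h z)\<^sup>2)"
    using integrable_real_mult_indicator[OF _ h_int(2), of "ball 0 \<rho>"]
      integrable_real_mult_indicator[OF _ h_int(3), of "ball 0 \<rho> \<times> ball 0 \<rho>"] by (simp_all add: mult.commute)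
qed

section \<open>Majorants for short and long jumps\<close>

text \<open>Since \<open>t \<le> 1 + t powr p\<close> for \<open>t \<ge> 0\<close>, integrability of
  \<open>h\<close> takes care of the summand 1 and boundedness of \<open>h\<close> of the
  power.\<close>

lemma product_dominated_lip:
  assumes p: "1 \<le> p" and f: "f \<in> Lp_space (ennreal p) m" and h: "h \<in> lip_compact_support"
  shows "product_dominated m f h"
proof -
  obtain C where C: "C \<ge> 0" "\<And>x. \<bar>h x\<bar> \<le> C"
    by (rule lip_compact_supportE[OF h]) (rule that)
  have "\<bar>f y\<bar> \<le> 1 + \<bar>f y\<bar> powr p" for y
  proof (cases "\<bar>f y\<bar> \<le> 1")
    case False
    then have "\<bar>f y\<bar> powr 1 \<le> \<bar>f y\<bar> powr p" using p by (intro powr_mono) auto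
    then show ?thesis by simp
  qed (simp add: add_increasing2)
  then have "\<bar>f y\<bar> * \<bar>h x\<bar> \<le> (1 + \<bar>f y\<bar> powr p) * \<bar>h x\<bar>" for x y
    by (intro mult_right_mono) auto
  also have "(1 + \<bar>f y\<bar> powr p) * \<bar>h x\<bar> \<le> C * \<bar>f y\<bar> powr p + \<bar>h x\<bar>" for x y
    using mult_left_mono[OF C(2)[of x], of "\<bar>f y\<bar> powr p"] by (simp add: algebra_simps)
  finally have "\<bar>f y\<bar> * \<bar>h x\<bar> \<le> C * \<bar>f y\<bar> powr p + \<bar>h x\<bar>" for x y .
  then show ?thesis
    unfolding product_dominated_def using f p C(1) lip_compact_support_integrable(1)[OF h]
    by (intro exI[of _ "\<lambda>y. C * \<bar>f y\<bar> powr p"] exI[of _ "\<lambda>x. \<bar>h x\<bar>"]) (auto simp: Lp_space_real)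
qed

text \<open>For jumps of length at least 1 the weight \<open>w\<close> equals 1, so inserting it
  into the majorant costs nothing there and makes it \<open>J\<close>-integrable. The second
  estimate serves the term in which \<open>g\<close> stands outside the increments.\<close>

lemma product_dominated_far:
  assumes "product_dominated m f g"
  obtains \<Phi> where "integrable J \<Phi>" "\<And>z. 0 \<le> \<Phi> z"
    "AE z in J. 1 \<le> dist (fst z) (snd z) \<longrightarrow>
     \<bar>\<Delta> f z\<bar> * \<bar>\<Delta> g z\<bar> \<le> \<Phi> z \<and> \<bar>\<Delta> f z\<bar> * \<bar>g (fst z)\<bar> \<le> \<Phi> z"
proof -
  obtain \<phi> \<psi> where \<phi>: "integrable m \<phi>" "\<And>x. 0 \<le> \<phi> x" and \<psi>: "integrable m \<psi>" "\<And>x. 0 \<le> \<psi> x"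
    and dom: "AE x in m. \<forall>y. \<bar>f y\<bar> * \<bar>g x\<bar> \<le> \<phi> y + \<psi> x"
    using assms unfolding product_dominated_def by auto
  \<comment> \<open>Expanding the product of increments gives four terms; in the sum of their bounds
    each of the four values of \<open>\<phi>\<close> and \<open>\<psi>\<close> occurs twice.\<close>
  let ?\<Phi> = "\<lambda>z. 2 * (\<phi> (fst z) * w z + \<phi> (snd z) * w z + (\<psi> (fst z) * w z + \<psi> (snd z) * w z))"
  have "integrable J ?\<Phi>"
    using integrable_weight[OF \<phi>(1)] integrable_weight[OF \<psi>(1)]
    by (intro integrable_mult_right Bochner_Integration.integrable_add)
  moreover have "0 \<le> ?\<Phi> z" for z using \<phi>(2) \<psi>(2) by simp
  moreover have "AE z in J. 1 \<le> dist (fst z) (snd z) \<longrightarrow>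
     \<bar>\<Delta> f z\<bar> * \<bar>\<Delta> g z\<bar> \<le> ?\<Phi> z \<and> \<bar>\<Delta> f z\<bar> * \<bar>g (fst z)\<bar> \<le> ?\<Phi> z"
    using AE_J[OF dom]
  proof (eventually_elim, intro impI)
    case (elim z)
    assume "1 \<le> dist (fst z) (snd z)"
    then have w1: "w z = 1" by (simp add: min_def)
    obtain x y where z: "z = (x, y)" by (cases z)
    have b: "\<bar>f x\<bar> * \<bar>g x\<bar> \<le> \<phi> x + \<psi> x" "\<bar>f y\<bar> * \<bar>g x\<bar> \<le> \<phi> y + \<psi> x"
      "\<bar>f x\<bar> * \<bar>g y\<bar> \<le> \<phi> x + \<psi> y" "\<bar>f y\<bar> * \<bar>g y\<bar> \<le> \<phi> y + \<psi> y"
      using elim by (auto simp: z)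
    have "\<bar>f x - f y\<bar> * \<bar>g x - g y\<bar> \<le> (\<bar>f x\<bar> + \<bar>f y\<bar>) * (\<bar>g x\<bar> + \<bar>g y\<bar>)"
      by (intro mult_mono) auto
    then have 1: "\<bar>f x - f y\<bar> * \<bar>g x - g y\<bar> \<le> 2 * (\<phi> x + \<phi> y + (\<psi> x + \<psi> y))"
      using b by (simp add: algebra_simps)
    have "\<bar>f x - f y\<bar> * \<bar>g x\<bar> \<le> (\<bar>f x\<bar> + \<bar>f y\<bar>) * \<bar>g x\<bar>"
      by (intro mult_right_mono) auto
    then have 2: "\<bar>f x - f y\<bar> * \<bar>g x\<bar> \<le> 2 * (\<phi> x + \<phi> y + (\<psi> x + \<psi> y))"
      using b \<phi>(2)[of x] \<phi>(2)[of y] \<psi>(2)[of x] \<psi>(2)[of y] by (simp add: algebra_simps)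
    show "\<bar>\<Delta> f z\<bar> * \<bar>\<Delta> g z\<bar> \<le> ?\<Phi> z \<and> \<bar>\<Delta> f z\<bar> * \<bar>g (fst z)\<bar> \<le> ?\<Phi> z"
      unfolding w1 using 1 2 by (simp add: z)
  qed
  ultimately show thesis by (rule that)
qed

lemma ball_dist_less_one:
  "x \<in> ball 0 \<rho> \<Longrightarrow> dist x y < 1 \<Longrightarrow> y \<in> ball (0::'a) (\<rho> + 1) \<and> x \<in> ball 0 (\<rho> + 1)"
  using dist_triangle[of 0 y x] by (simp add: dist_commute)

text \<open>A jump shorter than 1 from the ball of radius \<open>\<rho>\<close> stays in the ball of
  radius \<open>\<rho> + 1\<close>, where both energies are finite and bound the product. Long jumps
  are covered by \<open>\<Phi>\<close>.\<close>

lemma integrable_product_ball: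
  assumes f: "locally_finite_energy f" and g: "locally_finite_energy g" and fg: "product_dominated m f g"
  shows "integrable J (\<lambda>z. indicator (ball 0 \<rho>) (fst z) * (\<Delta> f z * \<Delta> g z))"
proof -
  have [measurable]: "f \<in> borel_measurable borel" "g \<in> borel_measurable borel" "ball 0 \<rho> \<in> sets (borel :: 'a measure)"
    using f g by (auto simp: locally_finite_energy_def)
  obtain \<Phi> where \<Phi>: "integrable J \<Phi>" "\<And>z. 0 \<le> \<Phi> z"
    and far: "AE z in J. 1 \<le> dist (fst z) (snd z) \<longrightarrow>
     \<bar>\<Delta> f z\<bar> * \<bar>\<Delta> g z\<bar> \<le> \<Phi> z \<and> \<bar>\<Delta> f z\<bar> * \<bar>g (fst z)\<bar> \<le> \<Phi> z"
    by (rule product_dominated_far[OF fg]) (rule that)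
  let ?i = "indicator (ball 0 (\<rho> + 1) \<times> ball 0 (\<rho> + 1)) :: 'a \<times> 'a \<Rightarrow> real"
  let ?G = "\<lambda>z. ?i z * (\<Delta> f z)\<^sup>2 + ?i z * (\<Delta> g z)\<^sup>2 + \<Phi> z"
  show ?thesis
  proof (rule Bochner_Integration.integrable_bound)
    show "integrable J ?G"
      using f g \<Phi>(1) by (intro Bochner_Integration.integrable_add) (auto simp: locally_finite_energy_def)
    show "AE z in J. norm (indicator (ball 0 \<rho>) (fst z) * (\<Delta> f z * \<Delta> g z)) \<le> norm (?G z)"
      using far
    proof eventually_elim
      case (elim z)
      have G: "norm (?G z) = ?G z" using \<Phi>(2)[of z] by simp
      show ?case
      proof (cases "fst z \<in> ball 0 \<rho>")
        case True
        have "\<bar>\<Delta> f z\<bar> * \<bar>\<Delta> g z\<bar> \<le> ?G z"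
        proof (cases "1 \<le> dist (fst z) (snd z)")
          case True
          then show ?thesis using elim by (simp add: add_increasing)
        next
          case False
          then have i: "?i z = 1"
            using ball_dist_less_one[OF True, of "snd z"] by (cases z) (auto simp: indicator_def)
          have "2 * (\<bar>\<Delta> f z\<bar> * \<bar>\<Delta> g z\<bar>) \<le> (\<Delta> f z)\<^sup>2 + (\<Delta> g z)\<^sup>2"
            using sum_squares_bound[of "\<bar>\<Delta> f z\<bar>" "\<bar>\<Delta> g z\<bar>"] by simp
          moreover have "0 \<le> \<bar>\<Delta> f z\<bar> * \<bar>\<Delta> g z\<bar>" by simp
          ultimately show ?thesis unfolding i using \<Phi>(2)[of z] by linarith
        qed
        then show ?thesis using True unfolding G by (simp add: abs_mult)
      next
        case False
        then show ?thesis by simp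
      qed
    qed
  qed (unfold measurable_J, measurable)
qed

text \<open>For short jumps the Lipschitz factor \<open>dist x y\<close> of \<open>h\<close> is
  attached to \<open>g x\<close>: then \<open>2 a b \<le> a\<^sup>2 + b\<^sup>2\<close> yields the
  local energy of \<open>f\<close> plus the local square of \<open>g\<close> times the weight. For
  long jumps \<open>\<bar>\<Delta> h z\<bar> \<le> 2 * C\<close> reduces the claim to
  \<open>\<Phi>\<close>.\<close>

lemma integrable_product_lip:
  assumes f: "locally_finite_energy f" and g: "locally_finite_energy g" and fg: "product_dominated m f g"
    and h: "h \<in> lip_compact_support"
  shows "integrable J (\<lambda>z. g (fst z) * (\<Delta> f z * \<Delta> h z))"
proof -
  obtain C \<rho> where C: "C \<ge> 0" "\<And>x. \<bar>h x\<bar> \<le> C" "\<And>x y. \<bar>h x - h y\<bar> \<le> C * dist x y"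
    "\<And>x. h x \<noteq> 0 \<Longrightarrow> x \<in> ball 0 \<rho>" and [measurable]: "h \<in> borel_measurable borel"
    by (rule lip_compact_supportE[OF h]) (rule that)
  have [measurable]: "f \<in> borel_measurable borel" "g \<in> borel_measurable borel" "ball 0 \<rho> \<in> sets (borel :: 'a measure)"
    using f g by (auto simp: locally_finite_energy_def)
  obtain \<Phi> where \<Phi>: "integrable J \<Phi>" "\<And>z. 0 \<le> \<Phi> z"
    and far: "AE z in J. 1 \<le> dist (fst z) (snd z) \<longrightarrow>
     \<bar>\<Delta> f z\<bar> * \<bar>\<Delta> g z\<bar> \<le> \<Phi> z \<and> \<bar>\<Delta> f z\<bar> * \<bar>g (fst z)\<bar> \<le> \<Phi> z"
    by (rule product_dominated_far[OF fg]) (rule that)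
  let ?B = "ball (0::'a) (\<rho> + 1)"
  let ?i = "indicator (?B \<times> ?B) :: 'a \<times> 'a \<Rightarrow> real"
  let ?g = "\<lambda>x. indicator ?B x * (g x)\<^sup>2"
  let ?G = "\<lambda>z. C * (?i z * (\<Delta> f z)\<^sup>2 + ?g (fst z) * w z) + 2 * C * \<Phi> z"
  show ?thesis
  proof (rule Bochner_Integration.integrable_bound)
    show "integrable J ?G"
      using f g \<Phi>(1)
      by (intro Bochner_Integration.integrable_add integrable_mult_right integrable_weight(1))
        (auto simp: locally_finite_energy_def)
    show "AE z in J. norm (g (fst z) * (\<Delta> f z * \<Delta> h z)) \<le> norm (?G z)"
      using far
    proof eventually_elim
      case (elim z)
      have w0: "0 \<le> w z" by simp
      have near0: "0 \<le> C * (?i z * (\<Delta> f z)\<^sup>2 + ?g (fst z) * w z)"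
        using C(1) w0 by (intro mult_nonneg_nonneg add_nonneg_nonneg) auto
      have far0: "0 \<le> 2 * C * \<Phi> z" using C(1) \<Phi>(2)[of z] by simp
      have G: "norm (?G z) = ?G z" using near0 far0 by simp
      have "\<bar>\<Delta> f z\<bar> * \<bar>g (fst z)\<bar> * \<bar>\<Delta> h z\<bar> \<le> ?G z"
      proof (cases "1 \<le> dist (fst z) (snd z)")
        case True
        have "\<bar>\<Delta> h z\<bar> \<le> 2 * C" using C(2)[of "fst z"] C(2)[of "snd z"] by linarith
        then have "\<bar>\<Delta> f z\<bar> * \<bar>g (fst z)\<bar> * \<bar>\<Delta> h z\<bar> \<le> \<Phi> z * (2 * C)"
          using True elim \<Phi>(2)[of z] by (intro mult_mono) auto
        then show ?thesis using near0 by (simp add: mult_ac)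
      next
        case near: False
        show ?thesis
        proof (cases "\<Delta> h z = 0")
          case True
          then show ?thesis using near0 far0 by simp
        next
          case False
          \<comment> \<open>A nonzero increment of \<open>h\<close> puts one endpoint in the
            support, and the short jump keeps the other within the enlarged ball.\<close>
          then have "fst z \<in> ball 0 \<rho> \<or> snd z \<in> ball 0 \<rho>"
            using C(4)[of "fst z"] C(4)[of "snd z"] by (cases "h (fst z) = 0") auto
          then have B: "fst z \<in> ?B" "snd z \<in> ?B"
            using near ball_dist_less_one[of "fst z" \<rho> "snd z"] ball_dist_less_one[of "snd z" \<rho> "fst z"]
            by (auto simp: dist_commute)
          then have i: "?i z = 1" "indicator ?B (fst z) = (1::real)" by (cases z; auto simp: indicator_def)+
          let ?d = "dist (fst z) (snd z)"
          have w: "w z = ?d\<^sup>2" using near power_le_one[of ?d 2] by (intro min_absorb2) simp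
          have "\<bar>\<Delta> f z\<bar> * \<bar>g (fst z)\<bar> * \<bar>\<Delta> h z\<bar> \<le> \<bar>\<Delta> f z\<bar> * \<bar>g (fst z)\<bar> * (C * ?d)"
            using C(3) by (intro mult_left_mono) auto
          also have "\<dots> = C * (\<bar>\<Delta> f z\<bar> * (\<bar>g (fst z)\<bar> * ?d))" by simp
          also have "\<dots> \<le> C * ((\<Delta> f z)\<^sup>2 + (g (fst z))\<^sup>2 * ?d\<^sup>2)"
          proof (rule mult_left_mono[OF _ C(1)])
            have "2 * (\<bar>\<Delta> f z\<bar> * (\<bar>g (fst z)\<bar> * ?d)) \<le> (\<Delta> f z)\<^sup>2 + (g (fst z))\<^sup>2 * ?d\<^sup>2"
              using sum_squares_bound[of "\<bar>\<Delta> f z\<bar>" "\<bar>g (fst z)\<bar> * ?d"] by (simp add: power_mult_distrib)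
            moreover have "0 \<le> \<bar>\<Delta> f z\<bar> * (\<bar>g (fst z)\<bar> * ?d)" by simp
            ultimately show "\<bar>\<Delta> f z\<bar> * (\<bar>g (fst z)\<bar> * ?d) \<le> (\<Delta> f z)\<^sup>2 + (g (fst z))\<^sup>2 * ?d\<^sup>2" by linarith
          qed
          finally show ?thesis using far0 by (simp only: i w) simp
        qed
      qed
      then show ?case unfolding G by (simp add: abs_mult mult_ac)
    qed
  qed (unfold measurable_J, measurable)
qed

section \<open>The Leibniz rule for the carre du champ\<close>

text \<open>Integrability of the product is available only with \<open>x\<close> restricted to a
  ball; balls of integer radius exhaust the space, and countably many null sets are
  discarded.\<close>

lemma AE_carre_du_champ_exists:
  assumes "locally_finite_energy f" "locally_finite_energy g" "product_dominated m f g"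
  shows "AE x in m. carre_du_champ_exists \<mu> f g x"
proof -
  have "AE x in m. \<forall>n. integrable (\<mu> x) (\<lambda>y. indicator (ball 0 (real n)) x * ((f x - f y) * (g x - g y)))"
    unfolding AE_all_countable using Fubini_J(1)[OF integrable_product_ball[OF assms]] by simp
  then show ?thesis
  proof eventually_elim
    case (elim x)
    obtain n where "norm x < real n" using reals_Archimedean2 by blast
    then show ?case using elim[rule_format, of n] by (simp add: carre_du_champ_exists_def)
  qed
qed

lemma carre_du_champ_product_rule:
  assumes f: "locally_finite_energy f" and g: "locally_finite_energy g" and fg: "product_dominated m f g"
    and h: "h \<in> lip_compact_support"
  shows "AE x in m. carre_du_champ_exists \<mu> f (\<lambda>y. g y * h y) x"
    and "integrable m (carre_du_champ \<mu> f (\<lambda>y. g y * h y))"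
    and "integrable m (\<lambda>x. g x * carre_du_champ \<mu> f h x)"
    and "integrable m (\<lambda>x. h x * carre_du_champ \<mu> f g x)"
    and "(LINT x|m. carre_du_champ \<mu> f (\<lambda>y. g y * h y) x) =
      (LINT x|m. g x * carre_du_champ \<mu> f h x) + (LINT x|m. h x * carre_du_champ \<mu> f g x)"
proof -
  obtain C \<rho> where C: "C \<ge> 0" "\<And>x. \<bar>h x\<bar> \<le> C" "\<And>x. h x \<noteq> 0 \<Longrightarrow> x \<in> ball 0 \<rho>"
    and [measurable]: "h \<in> borel_measurable borel"
    by (rule lip_compact_supportE[OF h]) (rule that)
  have [measurable]: "f \<in> borel_measurable borel" "g \<in> borel_measurable borel" "ball 0 \<rho> \<in> sets (borel :: 'a measure)"
    using f g by (auto simp: locally_finite_energy_def)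
  let ?gh = "\<lambda>z. \<Delta> f z * \<Delta> (\<lambda>y. g y * h y) z"
  let ?g = "\<lambda>z. g (fst z) * (\<Delta> f z * \<Delta> h z)"
  let ?h = "\<lambda>z. h (fst z) * (\<Delta> f z * \<Delta> g z)"
  have int_g: "integrable J ?g" by (rule integrable_product_lip[OF f g fg h])
  have int_h: "integrable J ?h"
  proof (rule Bochner_Integration.integrable_bound)
    show "integrable J (\<lambda>z. C * (indicator (ball 0 \<rho>) (fst z) * (\<Delta> f z * \<Delta> g z)))"
      using integrable_product_ball[OF f g fg] by (rule integrable_mult_right)
    \<comment> \<open>Multiplication by \<open>h\<close> is at most multiplication by
      \<open>C\<close> on the ball containing its support.\<close>
    have "\<bar>h x\<bar> * a \<le> C * (indicator (ball 0 \<rho>) x * a)" if "0 \<le> a" for x and a :: real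
      using that C(2)[of x] C(3)[of x] C(1) by (cases "h x = 0") (auto intro!: mult_right_mono simp: indicator_def)
    then show "AE z in J. norm (?h z) \<le> norm (C * (indicator (ball 0 \<rho>) (fst z) * (\<Delta> f z * \<Delta> g z)))"
      using C(1) by (simp add: abs_mult)
  qed (unfold measurable_J, measurable)
  note swap_h = integrable_J_swap[OF int_h]
  \<comment> \<open>The algebraic identity carries \<open>h\<close> at the second point. It is the
    swap of \<open>?h\<close>, because both increments change sign and their product does
    not.\<close>
  have split: "?gh = (\<lambda>z. ?g z + ?h (prod.swap z))"
    by (auto simp: algebra_simps)
  have int_gh: "integrable J ?gh"
    unfolding split using int_g swap_h(1) by (rule Bochner_Integration.integrable_add)
  show "AE x in m. carre_du_champ_exists \<mu> f (\<lambda>y. g y * h y) x"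
    using Fubini_J(1)[OF int_gh] by (simp add: carre_du_champ_exists_def)
  show "integrable m (carre_du_champ \<mu> f (\<lambda>y. g y * h y))"
    "integrable m (\<lambda>x. g x * carre_du_champ \<mu> f h x)"
    "integrable m (\<lambda>x. h x * carre_du_champ \<mu> f g x)"
    using Fubini_J(2)[OF int_gh] Fubini_J(2)[OF int_g] Fubini_J(2)[OF int_h]
    by (simp_all add: carre_du_champ_def[abs_def])
  have "(LINT z|J. ?gh z) = (LINT z|J. ?g z) + (LINT z|J. ?h z)"
    unfolding split using int_g swap_h by (subst Bochner_Integration.integral_add) simp_all
  then show "(LINT x|m. carre_du_champ \<mu> f (\<lambda>y. g y * h y) x) =
      (LINT x|m. g x * carre_du_champ \<mu> f h x) + (LINT x|m. h x * carre_du_champ \<mu> f g x)"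
    using Fubini_J(3)[OF int_gh] Fubini_J(3)[OF int_g] Fubini_J(3)[OF int_h]
    by (simp add: carre_du_champ_def)
qed

end

text \<open>The existence and integrability claims ensure that no integral in the final identity is
  merely the default value 0.\<close>

theorem theorem2:
  fixes \<mu> :: "real ^ 'd \<Rightarrow> (real ^ 'd) measure"
    and m :: "(real ^ 'd) measure"
    and p \<alpha> :: real and q :: ennreal
    and f g h :: "real ^ 'd \<Rightarrow> real"
  assumes "jump_kernel \<mu>"
    and "radon_measure m" and "full_support m"
    and "symmetric_kernel \<mu> m"
    and "\<exists>R\<^sub>0 r\<^sub>0. R\<^sub>0 > 3 * r\<^sub>0 \<and> r\<^sub>0 > 0 \<and> (\<forall>x. emeasure (\<mu> x) (ball x R\<^sub>0 - ball x r\<^sub>0) > 0)"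
    and "1 \<le> p" and "1 / ennreal p + 1 / q = 1"
    and "0 < \<alpha>" and "\<alpha> \<le> 2" and "jump_moment \<mu> \<alpha> < \<infinity>"
    and "f \<in> local_form_domain \<mu> m \<inter> Lp_space (ennreal p) m"
    and "g \<in> local_form_domain \<mu> m \<inter> Lp_space q m"
    and "h \<in> lip_compact_support"
  shows "(AE x in m. carre_du_champ_exists \<mu> f (\<lambda>y. g y * h y) x) \<and>
         (AE x in m. carre_du_champ_exists \<mu> f h x) \<and>
         (AE x in m. carre_du_champ_exists \<mu> f g x) \<and>
         integrable m (carre_du_champ \<mu> f (\<lambda>y. g y * h y)) \<and>
         integrable m (\<lambda>x. g x * carre_du_champ \<mu> f h x) \<and>
         integrable m (\<lambda>x. h x * carre_du_champ \<mu> f g x) \<and>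
         (LINT x|m. carre_du_champ \<mu> f (\<lambda>y. g y * h y) x) =
           (LINT x|m. g x * carre_du_champ \<mu> f h x) + (LINT x|m. h x * carre_du_champ \<mu> f g x)"
proof -
  interpret symmetric_jump \<mu> m "jump_moment \<mu> \<alpha>"
  proof
    fix x
    \<comment> \<open>Up to 1 a smaller exponent gives a larger power, and beyond 1 both minima
      equal 1. Hence the moment of order \<open>\<alpha>\<close> dominates the quadratic
      one.\<close>
    have "min 1 (t\<^sup>2) \<le> min 1 (t powr \<alpha>)" if "t \<ge> 0" for t :: real
    proof (cases "t \<le> 1")
      case True
      have "t\<^sup>2 \<le> t powr \<alpha>"
      proof (cases "t = 0")
        case False
        then have "t\<^sup>2 = t powr 2" using that by simp
        also have "\<dots> \<le> t powr \<alpha>" using that True assms(9) by (intro powr_mono') auto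
        finally show ?thesis .
      qed simp
      then show ?thesis by (rule min.mono[OF order_refl])
    next
      case False
      then have "1 \<le> t powr \<alpha>" using assms(8) by (simp add: ge_one_powr_ge_zero)
      then show ?thesis by simp
    qed
    then have "(\<integral>\<^sup>+ y. ennreal (min 1 ((dist x y)\<^sup>2)) \<partial>\<mu> x) \<le> (\<integral>\<^sup>+ y. ennreal (min 1 (norm (x - y) powr \<alpha>)) \<partial>\<mu> x)"
      by (intro nn_integral_mono ennreal_leI) (simp only: dist_norm norm_ge_zero)
    also have "\<dots> \<le> jump_moment \<mu> \<alpha>"
      unfolding jump_moment_def by (rule SUP_upper) simp
    finally show "(\<integral>\<^sup>+ y. ennreal (min 1 ((dist x y)\<^sup>2)) \<partial>\<mu> x) \<le> jump_moment \<mu> \<alpha>" .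
  qed (use assms in auto)
  have f: "locally_finite_energy f" and g: "locally_finite_energy g" and h: "locally_finite_energy h"
    using assms by (auto intro: locally_finite_energy_local locally_finite_energy_lip)
  have fg: "product_dominated m f g"
    using assms by (intro product_dominated_Lp[of p q]) auto
  have fh: "product_dominated m f h"
    using assms by (intro product_dominated_lip[of p]) auto
  show ?thesis
    using carre_du_champ_product_rule[OF f g fg assms(13)]
      AE_carre_du_champ_exists[OF f h fh] AE_carre_du_champ_exists[OF f g fg] by blast
qed

end
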